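(* Let $\Omega\subset\mathbb R^d$ be a domain of finite measure with buckling eigenvalues $\sigma_j$. Then for every $z\ge0$, $$R_1(z)=\sum_j(z-\sigma_j)_+\le\frac{2}{d+2}(2\pi)^{-d}B_d|\Omega|z^{1+\frac d2}.$$
   Context: Buckling eigenvalues $\sigma_j$ (with multiplicity): eigenvalues of $v\in H^2_0(\Omega)\setminus\{0\}$, $\int_\Omega\Delta v\Delta\phi=\sigma\int_\Omega\nabla v\cdot\nabla\phi$ for all $\phi\in H^2_0(\Omega)$, where $H^2_0(\Omega)$ is the closure of $C_c^\infty(\Omega)$ in $(\|f\|_2^2+\|\Delta f\|_2^2)^{1/2}$. $B_d$ is the volume of the unit ball in $\mathbb R^d$; $a_+=\max\{a,0\}$. *)

theory Defs
  imports "HOL-Analysis.Analysis"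
begin

definition partial :: "'n::finite \<Rightarrow> (real^'n \<Rightarrow> real) \<Rightarrow> real^'n \<Rightarrow> real" where
  "partial i f x = deriv (\<lambda>t. f (x + t *\<^sub>R axis i 1)) 0"

fun partial_iter :: "'n::finite list \<Rightarrow> (real^'n \<Rightarrow> real) \<Rightarrow> real^'n \<Rightarrow> real" where
  "partial_iter [] f = f"
| "partial_iter (i # is) f = partial i (partial_iter is f)"

(* C^infinity on R^d: every iterated partial derivative exists and is (Frechet) differentiable
   everywhere (hence all iterated partials exist and are continuous). *)
definition smooth_fun :: "(real^'n::finite \<Rightarrow> real) \<Rightarrow> bool" where
  "smooth_fun f \<longleftrightarrow> (\<forall>is x. partial_iter is f differentiable at x)"

definition grad :: "(real^'n::finite \<Rightarrow> real) \<Rightarrow> real^'n \<Rightarrow> real^'n" where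
  "grad f x = (\<chi> i. partial i f x)"

definition laplacian :: "(real^'n::finite \<Rightarrow> real) \<Rightarrow> real^'n \<Rightarrow> real" where
  "laplacian f x = (\<Sum>i\<in>UNIV. partial i (partial i f) x)"

(* C_c^infinity(Omega), functions extended by zero to all of R^d *)
definition Cc_inf :: "(real^'n::finite) set \<Rightarrow> (real^'n \<Rightarrow> real) set" where
  "Cc_inf \<Omega> = {f. smooth_fun f \<and> compact (closure {x. f x \<noteq> 0})
                  \<and> closure {x. f x \<noteq> 0} \<subseteq> \<Omega>}"

definition L2_conv :: "(real^'n::finite) set \<Rightarrow> (nat \<Rightarrow> real^'n \<Rightarrow> 'b::euclidean_space)
                        \<Rightarrow> (real^'n \<Rightarrow> 'b) \<Rightarrow> bool" where
  "L2_conv \<Omega> u v \<longleftrightarrow>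
     v \<in> borel_measurable (lebesgue_on \<Omega>) \<and>
     integrable (lebesgue_on \<Omega>) (\<lambda>x. (norm (v x))\<^sup>2) \<and>
     (\<forall>k. integrable (lebesgue_on \<Omega>) (\<lambda>x. (norm (u k x - v x))\<^sup>2)) \<and>
     ((\<lambda>k. integral\<^sup>L (lebesgue_on \<Omega>) (\<lambda>x. (norm (u k x - v x))\<^sup>2)) \<longlonglongrightarrow> 0)"

(* H20_rep Omega v g w: v is an element of H^2_0(Omega) (the closure of C_c^infinity(Omega)
   in the norm (||f||_2^2 + ||Delta f||_2^2)^(1/2)), obtained as the limit of a sequence phi_k
   in C_c^infinity(Omega) which is Cauchy in that norm; g and w are the L^2 limits of
   grad phi_k and Delta phi_k, i.e. grad v and Delta v (the gradients converge automatically,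
   since ||grad phi||_2^2 <= ||phi||_2 ||Delta phi||_2 for phi in C_c^infinity). *)
definition H20_rep :: "(real^'n::finite) set \<Rightarrow> (real^'n \<Rightarrow> real) \<Rightarrow> (real^'n \<Rightarrow> real^'n)
                        \<Rightarrow> (real^'n \<Rightarrow> real) \<Rightarrow> bool" where
  "H20_rep \<Omega> v g w \<longleftrightarrow>
     (\<exists>\<phi>. (\<forall>k. \<phi> k \<in> Cc_inf \<Omega>) \<and> L2_conv \<Omega> \<phi> v \<and>
          L2_conv \<Omega> (\<lambda>k. grad (\<phi> k)) g \<and> L2_conv \<Omega> (\<lambda>k. laplacian (\<phi> k)) w)"

definition H20 :: "(real^'n::finite) set \<Rightarrow> (real^'n \<Rightarrow> real) set" where
  "H20 \<Omega> = {v. \<exists>g w. H20_rep \<Omega> v g w}"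

definition buckling_eigenfunction :: "(real^'n::finite) set \<Rightarrow> real \<Rightarrow> (real^'n \<Rightarrow> real) \<Rightarrow> bool" where
  "buckling_eigenfunction \<Omega> \<sigma> v \<longleftrightarrow>
     v \<in> H20 \<Omega> \<and> \<not> (AE x in lebesgue_on \<Omega>. v x = 0) \<and>
     (\<forall>g w. H20_rep \<Omega> v g w \<longrightarrow>
        (\<forall>\<phi> g\<phi> w\<phi>. H20_rep \<Omega> \<phi> g\<phi> w\<phi> \<longrightarrow>
           (\<integral>x. w x * w\<phi> x \<partial>lebesgue_on \<Omega>) = \<sigma> * (\<integral>x. g x \<bullet> g\<phi> x \<partial>lebesgue_on \<Omega>)))"

definition lin_indep_on :: "(real^'n::finite) set \<Rightarrow> (real^'n \<Rightarrow> real) set \<Rightarrow> bool" where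
  "lin_indep_on \<Omega> V \<longleftrightarrow>
     (\<forall>c. (AE x in lebesgue_on \<Omega>. (\<Sum>v\<in>V. c v * v x) = 0) \<longrightarrow> (\<forall>v\<in>V. c v = 0))"

end

(* Let u_j be eigenfunctions whose gradients are orthonormal in L^2(Omega), so that
   sigma_j = ||Delta u_j||^2, and let F_j be the Fourier transform of u_j.  By Plancherel,
     sum (z - sigma_j)_+ <= (2 pi)^(-d) int (z - |xi|^2)_+ sum_j |xi|^2 |F_j(xi)|^2 dxi.
   Since |xi| |F_j(xi)| = |<grad u_j, (xi/|xi|) e^(i xi.x)>|, Bessel's inequality bounds the inner
   sum by |Omega|, and the integral of (z - |xi|^2)_+ is computed by slicing into balls.
   Everything is done for test functions approximating the u_j, whose gradients are only almost
   orthonormal; this costs a factor tending to 1.  That the Dirichlet form is definite on the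
   span of the u_j follows from a Poincare inequality, again a consequence of Plancherel. *)
theory Submission
  imports Defs "HOL-Probability.Probability"
begin

subsection \<open>Fourier transform of the Gaussian\<close>

text \<open>The elements of the closure space are known only through sequences of test functions, so
  all Fourier analysis is confined to continuous functions of compact support, and limits are taken
  only in integrals of products. Plancherel itself comes from inserting a Gaussian weight and
  removing it by monotone convergence. For a test function f with transform F there is the exact
  identity z ||grad f||^2 - ||Delta f||^2 = (2 pi)^(-d) int (z - |xi|^2) |xi|^2 |F|^2. The positive
  part on the right appears by discarding the frequencies |xi|^2 > z, the one on the left by summing
  only over eigenvalues below z; the Bessel bound holds for every subfamily. Gradients can be
  orthonormalised without disturbing the eigenvalues: testing the weak equation of u with v gives
  <Delta u, Delta v> = sigma_u <grad u, grad v>, and the symmetry of both forms makes gradients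
  belonging to different eigenvalues orthogonal. Gram-Schmidt therefore never mixes eigenvalues. It
  acts on coefficient vectors, so that the same combinations can be formed of the eigenfunctions and
  of their approximants.\<close>

lemma gaussian_fourier_real:
  fixes e r :: real
  assumes "e > 0"
  shows "integrable lborel (\<lambda>s. complex_of_real (exp (- ((e * s)\<^sup>2 / 2))) * iexp (s * r))"
    and "integral\<^sup>L lborel (\<lambda>s. complex_of_real (exp (- ((e * s)\<^sup>2 / 2))) * iexp (s * r))
         = complex_of_real (sqrt (2 * pi) / e * exp (- ((r / e)\<^sup>2 / 2)))"
proof -
  \<comment> \<open>\<open>n\<close> is the integrand of the characteristic function of the standard
    normal law at \<open>r / e\<close>. Substituting \<open>e * s\<close> for its variable gives the
    claimed integrand up to the normalisation \<open>sqrt (2 * pi)\<close>, and the Jacobian is the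
    factor \<open>1 / e\<close>.\<close>
  define n where "n s = complex_of_real (std_normal_density s) * iexp (s * (r / e))" for s
  have I: "integrable lborel n"
    unfolding n_def
    by (rule Bochner_Integration.integrable_bound[OF integrable_normal_density[of 1 0]])
      (auto simp: norm_mult)
  have "complex_of_real (exp (- ((r / e)\<^sup>2 / 2))) = char std_normal_distribution (r / e)"
    by (simp add: char_std_normal_distribution)
  also have "\<dots> = integral\<^sup>L lborel n"
    unfolding char_def n_def by (subst integral_density) (auto simp: scaleR_conv_of_real mult.commute)
  finally have V: "integral\<^sup>L lborel n = complex_of_real (exp (- ((r / e)\<^sup>2 / 2)))" by simp
  have eq: "(\<lambda>s. complex_of_real (exp (- ((e * s)\<^sup>2 / 2))) * iexp (s * r))
      = (\<lambda>s. complex_of_real (sqrt (2 * pi)) * n (0 + e * s))"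
    using assms by (auto simp: n_def std_normal_density_def fun_eq_iff)
  have H: "has_bochner_integral lborel n (complex_of_real (exp (- ((r / e)\<^sup>2 / 2))))"
    using I V by (simp add: has_bochner_integral_iff)
  have "has_bochner_integral lborel (\<lambda>s. n (0 + e * s)) (complex_of_real (exp (- ((r / e)\<^sup>2 / 2))) /\<^sub>R \<bar>e\<bar>)"
    using H assms by (subst (asm) lborel_has_bochner_integral_real_affine_iff[of e _ _ 0]) auto
  from has_bochner_integral_mult_right[OF this, of "complex_of_real (sqrt (2 * pi))"]
  have "has_bochner_integral lborel (\<lambda>s. complex_of_real (exp (- ((e * s)\<^sup>2 / 2))) * iexp (s * r))
     (complex_of_real (sqrt (2 * pi)) * (complex_of_real (exp (- ((r / e)\<^sup>2 / 2))) /\<^sub>R \<bar>e\<bar>))"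
    unfolding eq by simp
  then show "integrable lborel (\<lambda>s. complex_of_real (exp (- ((e * s)\<^sup>2 / 2))) * iexp (s * r))"
    "integral\<^sup>L lborel (\<lambda>s. complex_of_real (exp (- ((e * s)\<^sup>2 / 2))) * iexp (s * r))
         = complex_of_real (sqrt (2 * pi) / e * exp (- ((r / e)\<^sup>2 / 2)))"
    using assms by (auto simp: has_bochner_integral_iff scaleR_conv_of_real field_simps)
qed

text \<open>With the complex exponential in place of the cosine the integrand is a product over the
  coordinates, and \<open>lborel\<close> is the image of a product measure, so the one-dimensional
  integrals multiply. The real part is taken only at the end, since the cosine of a sum does not
  factor.\<close>

lemma gaussian_fourier_euclidean:
  fixes u :: "'a::euclidean_space" and e :: real
  assumes "e > 0"
  shows "integrable lborel (\<lambda>x. exp (- ((e * norm x)\<^sup>2 / 2)) * cos (x \<bullet> u))" (is ?I)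
    and "integral\<^sup>L lborel (\<lambda>x. exp (- ((e * norm x)\<^sup>2 / 2)) * cos (x \<bullet> u))
         = (sqrt (2 * pi) / e) ^ DIM('a) * exp (- ((norm u / e)\<^sup>2 / 2))" (is ?V)
proof -
  let ?c = "\<lambda>b s. complex_of_real (exp (- ((e * s)\<^sup>2 / 2))) * iexp (s * (u \<bullet> b))"
  let ?f = "\<lambda>x::'a. complex_of_real (exp (- ((e * norm x)\<^sup>2 / 2))) * iexp (x \<bullet> u)"
  let ?T = "\<lambda>f. \<Sum>b\<in>(Basis::'a set). f b *\<^sub>R b"
  interpret P: product_sigma_finite "\<lambda>b::'a. lborel :: real measure" by standard
  have fT: "?f (?T f) = (\<Prod>b\<in>Basis. ?c b (f b))" for f :: "'a \<Rightarrow> real"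
  proof -
    have n: "(norm (?T f))\<^sup>2 = (\<Sum>b\<in>Basis. (f b)\<^sup>2)"
      unfolding power2_norm_eq_inner by (subst euclidean_inner) (simp add: inner_sum_left inner_Basis if_distrib power2_eq_square cong: if_cong)
    have i: "?T f \<bullet> u = (\<Sum>b\<in>Basis. f b * (u \<bullet> b))"
      by (simp add: inner_commute[of _ u] inner_sum_right)
    have "?f (?T f) = exp (complex_of_real (- (e\<^sup>2 * (\<Sum>b\<in>Basis. (f b)\<^sup>2) / 2)) + \<i> * of_real (\<Sum>b\<in>Basis. f b * (u \<bullet> b)))"
      by (simp only: n i power_mult_distrib exp_add exp_of_real)
    also have "complex_of_real (- (e\<^sup>2 * (\<Sum>b\<in>Basis. (f b)\<^sup>2) / 2)) + \<i> * of_real (\<Sum>b\<in>Basis. f b * (u \<bullet> b))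
       = (\<Sum>b\<in>Basis. complex_of_real (- ((e * f b)\<^sup>2 / 2)) + \<i> * of_real (f b * (u \<bullet> b)))"
      by (simp add: sum.distrib sum_distrib_left sum_divide_distrib power_mult_distrib sum_negf sum_subtractf)
    also have "exp \<dots> = (\<Prod>b\<in>Basis. ?c b (f b))"
      by (subst exp_sum) (simp_all only: exp_add exp_of_real finite_Basis)
    finally show ?thesis .
  qed
  have T: "?T \<in> measurable (\<Pi>\<^sub>M b\<in>(Basis::'a set). lborel) borel" by measurable
  have m: "?f \<in> borel_measurable borel" by measurable
  have "integrable (\<Pi>\<^sub>M b\<in>(Basis::'a set). lborel) (\<lambda>f. \<Prod>b\<in>Basis. ?c b (f b))"
    by (rule P.product_integrable_prod) (simp_all only: finite_Basis gaussian_fourier_real(1)[OF assms])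
  then have I: "integrable lborel ?f"
    unfolding fT[symmetric] lborel_eq[where 'a='a] integrable_distr_eq[OF T m] .
  have "integral\<^sup>L lborel ?f = (\<integral>f. (\<Prod>b\<in>Basis. ?c b (f b)) \<partial>(\<Pi>\<^sub>M b\<in>(Basis::'a set). lborel))"
    unfolding fT[symmetric] lborel_eq[where 'a='a] integral_distr[OF T m] ..
  also have "\<dots> = (\<Prod>b\<in>(Basis::'a set). integral\<^sup>L lborel (?c b))"
    by (rule P.product_integral_prod) (simp_all only: finite_Basis gaussian_fourier_real(1)[OF assms])
  also have "\<dots> = (\<Prod>b\<in>(Basis::'a set). complex_of_real (sqrt (2 * pi) / e * exp (- (((u \<bullet> b) / e)\<^sup>2 / 2))))"
    by (intro prod.cong refl gaussian_fourier_real(2)[OF assms])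
  also have "\<dots> = complex_of_real (\<Prod>b\<in>(Basis::'a set). sqrt (2 * pi) / e * exp (- (((u \<bullet> b) / e)\<^sup>2 / 2)))"
    by (rule of_real_prod[symmetric])
  also have "(\<Prod>b\<in>(Basis::'a set). sqrt (2 * pi) / e * exp (- (((u \<bullet> b) / e)\<^sup>2 / 2)))
     = (sqrt (2 * pi) / e) ^ DIM('a) * exp (\<Sum>b\<in>(Basis::'a set). - (((u \<bullet> b) / e)\<^sup>2 / 2))"
    by (simp only: prod.distrib prod_constant exp_sum finite_Basis)
  also have "(\<Sum>b\<in>(Basis::'a set). - (((u \<bullet> b) / e)\<^sup>2 / 2)) = - ((norm u / e)\<^sup>2 / 2)"
  proof -
    have "(norm u)\<^sup>2 = (\<Sum>b\<in>Basis. (u \<bullet> b)\<^sup>2)"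
      unfolding power2_norm_eq_inner by (subst euclidean_inner) (simp add: power2_eq_square)
    then show ?thesis
      by (simp add: sum_negf power_divide sum_divide_distrib)
  qed
  finally have V: "integral\<^sup>L lborel ?f = complex_of_real ((sqrt (2 * pi) / e) ^ DIM('a) * exp (- ((norm u / e)\<^sup>2 / 2)))" .
  have Re: "Re (?f x) = exp (- ((e * norm x)\<^sup>2 / 2)) * cos (x \<bullet> u)" for x
    by (simp only: Re_complex_of_real Re_exp times_complex.sel Im_complex_of_real) simp
  show ?I
    using integrable_Re[OF I] unfolding Re .
  show ?V
    using integral_Re[OF I] unfolding Re V by simp
qed

lemma gaussian_euclidean:
  fixes e :: real
  assumes "e > 0"
  shows "integrable lborel (\<lambda>x::'a::euclidean_space. exp (- ((e * norm x)\<^sup>2 / 2)))"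
    and "integral\<^sup>L lborel (\<lambda>x::'a. exp (- ((e * norm x)\<^sup>2 / 2))) = (sqrt (2 * pi) / e) ^ DIM('a)"
  using gaussian_fourier_euclidean[OF assms, of "0::'a"] by simp_all

subsection \<open>Plancherel for continuous functions with compact support\<close>

lemma compact_support_integrable:
  fixes f :: "'a::euclidean_space \<Rightarrow> 'b::{banach, second_countable_topology}"
  assumes "continuous_on UNIV f" "compact K" "\<And>x. x \<notin> K \<Longrightarrow> f x = 0"
  shows "integrable lborel f"
proof -
  have "integrable lborel (\<lambda>x. indicator K x *\<^sub>R f x)"
    using assms by (intro borel_integrable_compact) (auto intro: continuous_on_subset)
  also have "(\<lambda>x. indicator K x *\<^sub>R f x) = f"
    using assms(3) by (auto simp: indicator_def fun_eq_iff)
  finally show ?thesis .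
qed

lemma compact_support_bounded:
  fixes f :: "'a::topological_space \<Rightarrow> 'b::real_normed_vector"
  assumes "continuous_on UNIV f" "compact K" "\<And>x. x \<notin> K \<Longrightarrow> f x = 0"
  obtains B where "B \<ge> 0" "\<And>x. norm (f x) \<le> B"
proof -
  have "bounded (f ` K)"
    using assms by (intro compact_imp_bounded compact_continuous_image) (auto intro: continuous_on_subset)
  then obtain B where "B > 0" "\<forall>x\<in>K. norm (f x) \<le> B"
    by (auto simp: bounded_pos)
  then have "norm (f x) \<le> B" for x using assms(3)[of x] by (cases "x \<in> K") auto
  with \<open>B > 0\<close> show thesis using that[of B] by auto
qed

text \<open>For real f, \<open>cos_transform\<close> and \<open>sin_transform\<close> are up to sign
  the real and imaginary parts of the unnormalised Fourier transform, and
  \<open>fourier_power\<close> below is its squared modulus. All integrals thus stay real.\<close>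

definition cos_transform :: "('a::euclidean_space \<Rightarrow> real) \<Rightarrow> 'a \<Rightarrow> real" where
  "cos_transform f \<xi> = (\<integral>x. f x * cos (\<xi> \<bullet> x) \<partial>lborel)"

definition sin_transform :: "('a::euclidean_space \<Rightarrow> real) \<Rightarrow> 'a \<Rightarrow> real" where
  "sin_transform f \<xi> = (\<integral>x. f x * sin (\<xi> \<bullet> x) \<partial>lborel)"

definition fourier_power :: "('a::euclidean_space \<Rightarrow> real) \<Rightarrow> 'a \<Rightarrow> real" where
  "fourier_power f \<xi> = (cos_transform f \<xi>)\<^sup>2 + (sin_transform f \<xi>)\<^sup>2"

lemma measurable_cos_transform [measurable]:
  assumes [measurable]: "f \<in> borel_measurable borel"
  shows "cos_transform f \<in> borel_measurable borel"
  unfolding cos_transform_def[abs_def] by measurable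

lemma measurable_sin_transform [measurable]:
  assumes [measurable]: "f \<in> borel_measurable borel"
  shows "sin_transform f \<in> borel_measurable borel"
  unfolding sin_transform_def[abs_def] by measurable

lemma measurable_fourier_power [measurable]:
  assumes [measurable]: "f \<in> borel_measurable borel"
  shows "fourier_power f \<in> borel_measurable borel"
  unfolding fourier_power_def[abs_def] by measurable

lemma fourier_power_nonneg: "fourier_power f \<xi> \<ge> 0"
  by (simp add: fourier_power_def)

lemma integrable_mult_bounded:
  fixes f g :: "'a \<Rightarrow> real"
  assumes "integrable M f" "g \<in> borel_measurable M" "\<And>x. \<bar>g x\<bar> \<le> B"
  shows "integrable M (\<lambda>x. f x * g x)"
proof (rule Bochner_Integration.integrable_bound)
  show "integrable M (\<lambda>x. B * f x)" using assms by simp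
  show "AE x in M. norm (f x * g x) \<le> norm (B * f x)"
  proof (rule AE_I2)
    fix x
    have "\<bar>f x\<bar> * \<bar>g x\<bar> \<le> \<bar>f x\<bar> * \<bar>B\<bar>" using assms(3)[of x] by (intro mult_left_mono) auto
    then show "norm (f x * g x) \<le> norm (B * f x)" by (simp add: abs_mult mult.commute)
  qed
qed (use assms in auto)

text \<open>Justifies both exchanges of integrals in \<open>integral_weighted_fourier_power\<close>:
  \<open>h\<close> is first a cosine and then an inner integral bounded by the L1 norm.\<close>

lemma integrable_pair_bounded:
  fixes f :: "'a::euclidean_space \<Rightarrow> real" and g :: "'b::euclidean_space \<Rightarrow> real"
  assumes f: "integrable lborel f" and g: "integrable lborel g"
    and h: "h \<in> borel_measurable (lborel \<Otimes>\<^sub>M lborel)" "\<And>p. \<bar>h p\<bar> \<le> B"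
  shows "integrable (lborel \<Otimes>\<^sub>M lborel) (\<lambda>(x, y). f x * g y * h (x, y))"
proof -
  have fm[measurable]: "f \<in> borel_measurable borel" "g \<in> borel_measurable borel"
    using f g by (auto dest: borel_measurable_integrable)
  have "integrable (lborel \<Otimes>\<^sub>M lborel) (\<lambda>p. f (fst p) * g (snd p))"
  proof (rule lborel_pair.Fubini_integrable)
    show "integrable lborel (\<lambda>x. \<integral>y. norm (f (fst (x, y)) * g (snd (x, y))) \<partial>lborel)"
      using f by (simp add: abs_mult)
    show "AE x in lborel. integrable lborel (\<lambda>y. f (fst (x, y)) * g (snd (x, y)))"
      using g by simp
  qed measurable
  from integrable_mult_bounded[OF this h]
  show ?thesis by (simp add: case_prod_beta')
qed

lemma cos_transform_bounded:
  assumes "integrable lborel f"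
  shows "\<bar>cos_transform f \<xi>\<bar> \<le> (\<integral>x. \<bar>f x\<bar> \<partial>lborel)" "\<bar>sin_transform f \<xi>\<bar> \<le> (\<integral>x. \<bar>f x\<bar> \<partial>lborel)"
proof -
  have m[measurable]: "f \<in> borel_measurable borel" using assms by (auto dest: borel_measurable_integrable)
  have le: "\<bar>f x * cos (\<xi> \<bullet> x)\<bar> \<le> \<bar>f x\<bar>" "\<bar>f x * sin (\<xi> \<bullet> x)\<bar> \<le> \<bar>f x\<bar>" for x
    using mult_left_mono[of "\<bar>cos (\<xi> \<bullet> x)\<bar>" 1 "\<bar>f x\<bar>"] mult_left_mono[of "\<bar>sin (\<xi> \<bullet> x)\<bar>" 1 "\<bar>f x\<bar>"]
    by (simp_all add: abs_mult)
  show "\<bar>cos_transform f \<xi>\<bar> \<le> (\<integral>x. \<bar>f x\<bar> \<partial>lborel)"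
    unfolding cos_transform_def
    by (rule order_trans[OF integral_abs_bound]) (use assms le in \<open>auto intro!: integral_mono integrable_abs integrable_mult_bounded[where B=1]\<close>)
  show "\<bar>sin_transform f \<xi>\<bar> \<le> (\<integral>x. \<bar>f x\<bar> \<partial>lborel)"
    unfolding sin_transform_def
    by (rule order_trans[OF integral_abs_bound]) (use assms le in \<open>auto intro!: integral_mono integrable_abs integrable_mult_bounded[where B=1]\<close>)
qed

text \<open>Integrability of f gives only boundedness of its transform; the decay at infinity is
  supplied by the Gaussian.\<close>

lemma integrable_mult_gaussian_weight:
  assumes f: "integrable lborel f" and e: "e > 0"
  shows "integrable lborel (\<lambda>\<xi>. exp (- ((e * norm \<xi>)\<^sup>2 / 2)) * fourier_power f \<xi>)"
proof (rule integrable_mult_bounded)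
  let ?A = "\<integral>x. \<bar>f x\<bar> \<partial>lborel"
  show "\<bar>fourier_power f \<xi>\<bar> \<le> ?A\<^sup>2 + ?A\<^sup>2" for \<xi>
    using power_mono[OF cos_transform_bounded(1)[OF f, of \<xi>], of 2] power_mono[OF cos_transform_bounded(2)[OF f, of \<xi>], of 2]
    by (simp add: fourier_power_def)
  have "f \<in> borel_measurable borel" using f by (auto dest: borel_measurable_integrable)
  then show "fourier_power f \<in> borel_measurable lborel" by simp
qed (rule gaussian_euclidean(1)[OF e])

text \<open>The product of the transform with its conjugate as a double integral, by the addition
  theorem for the cosine. In this form \<xi> occurs only inside one cosine, whose integral against
  the Gaussian is known.\<close>

lemma fourier_power_eq:
  assumes f: "integrable lborel f"
  shows "fourier_power f \<xi> = (\<integral>x. f x * (\<integral>y. f y * cos (\<xi> \<bullet> (x - y)) \<partial>lborel) \<partial>lborel)"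
proof -
  have m[measurable]: "f \<in> borel_measurable borel" using f by (auto dest: borel_measurable_integrable)
  have i: "integrable lborel (\<lambda>x. f x * cos (\<xi> \<bullet> x))" "integrable lborel (\<lambda>x. f x * sin (\<xi> \<bullet> x))"
    by (auto intro!: integrable_mult_bounded[where B=1] f)
  have 1: "(\<integral>y. f y * cos (\<xi> \<bullet> (x - y)) \<partial>lborel) = cos (\<xi> \<bullet> x) * cos_transform f \<xi> + sin (\<xi> \<bullet> x) * sin_transform f \<xi>" for x
  proof -
    have "(\<integral>y. f y * cos (\<xi> \<bullet> (x - y)) \<partial>lborel)
        = (\<integral>y. cos (\<xi> \<bullet> x) * (f y * cos (\<xi> \<bullet> y)) + sin (\<xi> \<bullet> x) * (f y * sin (\<xi> \<bullet> y)) \<partial>lborel)"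
      by (intro Bochner_Integration.integral_cong) (auto simp: inner_diff_right cos_diff algebra_simps)
    also have "\<dots> = cos (\<xi> \<bullet> x) * cos_transform f \<xi> + sin (\<xi> \<bullet> x) * sin_transform f \<xi>"
      unfolding cos_transform_def sin_transform_def using i by simp
    finally show ?thesis .
  qed
  have "(\<integral>x. f x * (\<integral>y. f y * cos (\<xi> \<bullet> (x - y)) \<partial>lborel) \<partial>lborel)
     = (\<integral>x. cos_transform f \<xi> * (f x * cos (\<xi> \<bullet> x)) + sin_transform f \<xi> * (f x * sin (\<xi> \<bullet> x)) \<partial>lborel)"
    unfolding 1 by (intro Bochner_Integration.integral_cong) (auto simp: algebra_simps)
  also have "\<dots> = fourier_power f \<xi>"
    unfolding fourier_power_def power2_eq_square using i by (simp add: cos_transform_def[symmetric] sin_transform_def[symmetric])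
  finally show ?thesis by simp
qed

text \<open>The Gaussian weight makes Fubini applicable; its transform is an approximate identity of width e.\<close>

lemma integral_weighted_fourier_power:
  fixes f :: "'a::euclidean_space \<Rightarrow> real"
  assumes f: "integrable lborel f" and e: "e > 0"
  shows "(\<integral>\<xi>. exp (- ((e * norm \<xi>)\<^sup>2 / 2)) * fourier_power f \<xi> \<partial>lborel)
    = sqrt (2 * pi) ^ DIM('a) * (\<integral>x. f x * (\<integral>t. f (x + e *\<^sub>R t) * exp (- ((norm t)\<^sup>2 / 2)) \<partial>lborel) \<partial>lborel)"
proof -
  have m[measurable]: "f \<in> borel_measurable borel" using f by (auto dest: borel_measurable_integrable)
  let ?w = "\<lambda>\<xi>::'a. exp (- ((e * norm \<xi>)\<^sup>2 / 2))"
  let ?g = "\<lambda>\<xi> x. \<integral>y. f y * cos (\<xi> \<bullet> (x - y)) \<partial>lborel"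
  have w: "integrable lborel ?w" by (rule gaussian_euclidean(1)[OF e])
  have gb: "\<bar>?g \<xi> x\<bar> \<le> (\<integral>x. \<bar>f x\<bar> \<partial>lborel)" for \<xi> x :: 'a
  proof -
    have "\<bar>f y * cos (\<xi> \<bullet> (x - y))\<bar> \<le> \<bar>f y\<bar>" for y
      using mult_left_mono[of "\<bar>cos (\<xi> \<bullet> (x - y))\<bar>" 1 "\<bar>f y\<bar>"] by (simp add: abs_mult)
    then show ?thesis
      by (intro order_trans[OF integral_abs_bound] integral_mono integrable_abs integrable_mult_bounded[where B=1])
        (use f in auto)
  qed
  have inner: "(\<integral>\<xi>. ?w \<xi> * ?g \<xi> x \<partial>lborel)
      = sqrt (2 * pi) ^ DIM('a) * (\<integral>t. f (x + e *\<^sub>R t) * exp (- ((norm t)\<^sup>2 / 2)) \<partial>lborel)" for x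
  proof -
    let ?h = "\<lambda>p::'a\<times>'a. cos (fst p \<bullet> (x - snd p))"
    have "(\<integral>\<xi>. ?w \<xi> * ?g \<xi> x \<partial>lborel) = (\<integral>\<xi>. (\<integral>y. ?w \<xi> * f y * cos (\<xi> \<bullet> (x - y)) \<partial>lborel) \<partial>lborel)"
      by (simp add: mult.assoc)
    also have "\<dots> = (\<integral>y. (\<integral>\<xi>. ?w \<xi> * f y * cos (\<xi> \<bullet> (x - y)) \<partial>lborel) \<partial>lborel)"
    proof (rule lborel_pair.Fubini_integral[symmetric])
      have "integrable (lborel \<Otimes>\<^sub>M lborel) (\<lambda>(\<xi>, y). ?w \<xi> * f y * ?h (\<xi>, y))"
        by (rule integrable_pair_bounded[where B=1]) (use w f in auto)
      then show "integrable (lborel \<Otimes>\<^sub>M lborel) (\<lambda>(\<xi>, y). ?w \<xi> * f y * cos (\<xi> \<bullet> (x - y)))" by simp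
    qed
    also have "\<dots> = (\<integral>y. f y * ((sqrt (2 * pi) / e) ^ DIM('a) * exp (- ((norm (x - y) / e)\<^sup>2 / 2))) \<partial>lborel)"
    proof (intro Bochner_Integration.integral_cong refl)
      fix y
      have "(\<integral>\<xi>. ?w \<xi> * f y * cos (\<xi> \<bullet> (x - y)) \<partial>lborel) = (\<integral>\<xi>. f y * (?w \<xi> * cos (\<xi> \<bullet> (x - y))) \<partial>lborel)"
        by (simp add: mult_ac)
      also have "\<dots> = f y * ((sqrt (2 * pi) / e) ^ DIM('a) * exp (- ((norm (x - y) / e)\<^sup>2 / 2)))"
        by (simp add: gaussian_fourier_euclidean(2)[OF e])
      finally show "(\<integral>\<xi>. ?w \<xi> * f y * cos (\<xi> \<bullet> (x - y)) \<partial>lborel) = \<dots>" .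
    qed
    \<comment> \<open>Substitution of \<open>x + e *\<^sub>R y\<close> for \<open>y\<close>; its
      Jacobian \<open>e ^ DIM('a)\<close> cancels the power of \<open>1 / e\<close> in the transform
      of the Gaussian.\<close>
    also have "\<dots> = (\<integral>y. (e ^ DIM('a)) * (f (x + e *\<^sub>R y) * ((sqrt (2 * pi) / e) ^ DIM('a) * exp (- ((norm (x - (x + e *\<^sub>R y)) / e)\<^sup>2 / 2)))) \<partial>lborel)"
      using e by (subst lborel_affine[of e x]) (auto simp: integral_density integral_distr)
    also have "\<dots> = (\<integral>y. sqrt (2 * pi) ^ DIM('a) * (f (x + e *\<^sub>R y) * exp (- ((norm y)\<^sup>2 / 2))) \<partial>lborel)"
      using e by (intro Bochner_Integration.integral_cong) (auto simp: power_divide)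
    finally show ?thesis by simp
  qed
  have "(\<integral>\<xi>. ?w \<xi> * fourier_power f \<xi> \<partial>lborel) = (\<integral>\<xi>. (\<integral>x. ?w \<xi> * f x * ?g \<xi> x \<partial>lborel) \<partial>lborel)"
    by (simp add: fourier_power_eq[OF f] mult.assoc)
  also have "\<dots> = (\<integral>x. (\<integral>\<xi>. ?w \<xi> * f x * ?g \<xi> x \<partial>lborel) \<partial>lborel)"
  proof (rule lborel_pair.Fubini_integral[symmetric])
    have "integrable (lborel \<Otimes>\<^sub>M lborel) (\<lambda>(\<xi>, x). ?w \<xi> * f x * (\<lambda>p. ?g (fst p) (snd p)) (\<xi>, x))"
      by (rule integrable_pair_bounded[where B="\<integral>x. \<bar>f x\<bar> \<partial>lborel"]) (use gb in \<open>auto intro!: w f\<close>)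
    then show "integrable (lborel \<Otimes>\<^sub>M lborel) (\<lambda>(\<xi>, x). ?w \<xi> * f x * ?g \<xi> x)" by simp
  qed
  also have "\<dots> = (\<integral>x. f x * (\<integral>\<xi>. ?w \<xi> * ?g \<xi> x \<partial>lborel) \<partial>lborel)"
  proof (intro Bochner_Integration.integral_cong refl)
    fix x
    have "(\<integral>\<xi>. ?w \<xi> * f x * ?g \<xi> x \<partial>lborel) = (\<integral>\<xi>. f x * (?w \<xi> * ?g \<xi> x) \<partial>lborel)"
      by (intro Bochner_Integration.integral_cong refl) (simp only: mult_ac)
    then show "(\<integral>\<xi>. ?w \<xi> * f x * ?g \<xi> x \<partial>lborel) = f x * (\<integral>\<xi>. ?w \<xi> * ?g \<xi> x \<partial>lborel)"
      by (simp only: integral_mult_right_zero)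
  qed
  also have "\<dots> = (\<integral>x. sqrt (2 * pi) ^ DIM('a) * (f x * (\<integral>t. f (x + e *\<^sub>R t) * exp (- ((norm t)\<^sup>2 / 2)) \<partial>lborel)) \<partial>lborel)"
    unfolding inner by (intro Bochner_Integration.integral_cong refl) (simp only: mult_ac)
  finally show ?thesis by (simp only: integral_mult_right_zero)
qed

text \<open>The Gaussian width \<open>e k\<close> is sent to 0 in
  \<open>integral_weighted_fourier_power\<close>. On the right, dominated convergence is used twice:
  for the inner integral by continuity and boundedness of f, for the outer one by its integrability.
  The constant collects one factor \<open>sqrt (2 * pi) ^ DIM('a)\<close> from that identity and one
  from the mass of the Gaussian.\<close>

theorem plancherel:
  fixes f :: "'a::euclidean_space \<Rightarrow> real"
  assumes cont: "continuous_on UNIV f" and K: "compact K" "\<And>x. x \<notin> K \<Longrightarrow> f x = 0"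
  shows "integrable lborel (fourier_power f)"
    and "integral\<^sup>L lborel (fourier_power f) = (2 * pi) ^ DIM('a) * (\<integral>x. (f x)\<^sup>2 \<partial>lborel)"
proof -
  have f: "integrable lborel f" by (rule compact_support_integrable[OF assms])
  then have m[measurable]: "f \<in> borel_measurable borel" by (auto dest: borel_measurable_integrable)
  obtain B where B: "B \<ge> 0" "\<And>x. norm (f x) \<le> B" using compact_support_bounded[OF assms] by blast
  define e :: "nat \<Rightarrow> real" where "e k = 1 / real (Suc k)" for k
  have e0: "e k > 0" for k by (simp add: e_def)
  have elim: "e \<longlonglongrightarrow> 0" unfolding e_def using LIMSEQ_inverse_real_of_nat by (simp add: inverse_eq_divide)
  let ?\<gamma> = "\<lambda>t::'a. exp (- ((norm t)\<^sup>2 / 2))"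
  have g: "integrable lborel ?\<gamma>" "integral\<^sup>L lborel ?\<gamma> = sqrt (2 * pi) ^ DIM('a)"
    using gaussian_euclidean[of 1, where 'a='a] by simp_all
  have fcont: "isCont f x" for x using cont by (simp add: continuous_on_eq_continuous_at)
  have ib: "norm (f (x + e k *\<^sub>R t) * ?\<gamma> t) \<le> B * ?\<gamma> t" for x k t
    using B(2)[of "x + e k *\<^sub>R t"] by (simp add: abs_mult)
  have inner: "(\<lambda>k. \<integral>t. f (x + e k *\<^sub>R t) * ?\<gamma> t \<partial>lborel) \<longlonglongrightarrow> (\<integral>t. f x * ?\<gamma> t \<partial>lborel)" for x
  proof (rule integral_dominated_convergence[where w="\<lambda>t. B * ?\<gamma> t"])
    show "AE t in lborel. (\<lambda>k. f (x + e k *\<^sub>R t) * ?\<gamma> t) \<longlonglongrightarrow> f x * ?\<gamma> t"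
    proof (rule AE_I2)
      fix t
      have "(\<lambda>k. x + e k *\<^sub>R t) \<longlonglongrightarrow> x + 0 *\<^sub>R t" by (intro tendsto_intros elim)
      then have "(\<lambda>k. f (x + e k *\<^sub>R t)) \<longlonglongrightarrow> f x"
        using isCont_tendsto_compose[OF fcont] by simp
      then show "(\<lambda>k. f (x + e k *\<^sub>R t) * ?\<gamma> t) \<longlonglongrightarrow> f x * ?\<gamma> t" by (intro tendsto_intros)
    qed
    show "AE t in lborel. norm (f (x + e k *\<^sub>R t) * ?\<gamma> t) \<le> B * ?\<gamma> t" for k
      using ib by simp
  qed (use g in auto)
  have "(\<lambda>k. \<integral>x. f x * (\<integral>t. f (x + e k *\<^sub>R t) * ?\<gamma> t \<partial>lborel) \<partial>lborel) \<longlonglongrightarrow> (\<integral>x. f x * (\<integral>t. f x * ?\<gamma> t \<partial>lborel) \<partial>lborel)"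
  proof (rule integral_dominated_convergence[where w="\<lambda>x. \<bar>f x\<bar> * (B * integral\<^sup>L lborel ?\<gamma>)"])
    show "AE x in lborel. (\<lambda>k. f x * (\<integral>t. f (x + e k *\<^sub>R t) * ?\<gamma> t \<partial>lborel)) \<longlonglongrightarrow> f x * (\<integral>t. f x * ?\<gamma> t \<partial>lborel)"
      by (intro AE_I2 tendsto_intros inner)
    show "AE x in lborel. norm (f x * (\<integral>t. f (x + e k *\<^sub>R t) * ?\<gamma> t \<partial>lborel)) \<le> \<bar>f x\<bar> * (B * integral\<^sup>L lborel ?\<gamma>)" for k
    proof (rule AE_I2)
      fix x
      have "\<bar>\<integral>t. f (x + e k *\<^sub>R t) * ?\<gamma> t \<partial>lborel\<bar> \<le> (\<integral>t. B * ?\<gamma> t \<partial>lborel)"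
        using ib[of x k]
        by (intro order_trans[OF integral_abs_bound] integral_mono integrable_abs
            Bochner_Integration.integrable_bound[OF integrable_mult_right[OF g(1), of B]]) (use g B(1) in auto)
      then show "norm (f x * (\<integral>t. f (x + e k *\<^sub>R t) * ?\<gamma> t \<partial>lborel)) \<le> \<bar>f x\<bar> * (B * integral\<^sup>L lborel ?\<gamma>)"
        by (simp add: abs_mult mult_left_mono)
    qed
  qed (use f in auto)
  also have "(\<integral>x. f x * (\<integral>t. f x * ?\<gamma> t \<partial>lborel) \<partial>lborel) = sqrt (2 * pi) ^ DIM('a) * (\<integral>x. (f x)\<^sup>2 \<partial>lborel)"
    unfolding integral_mult_right_zero g(2)
    by (subst integral_mult_right_zero[symmetric], intro Bochner_Integration.integral_cong refl)
      (simp add: power2_eq_square)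
  finally have L: "(\<lambda>k. \<integral>\<xi>. exp (- ((e k * norm \<xi>)\<^sup>2 / 2)) * fourier_power f \<xi> \<partial>lborel)
      \<longlonglongrightarrow> sqrt (2 * pi) ^ DIM('a) * (sqrt (2 * pi) ^ DIM('a) * (\<integral>x. (f x)\<^sup>2 \<partial>lborel))"
    unfolding integral_weighted_fourier_power[OF f e0] by (intro tendsto_intros)
  have "sqrt (2 * pi) ^ DIM('a) * sqrt (2 * pi) ^ DIM('a) = (2 * pi) ^ DIM('a)"
    unfolding power_mult_distrib[symmetric] by (simp add: real_sqrt_mult_self[of "2 * pi"] del: real_sqrt_mult)
  then have c: "sqrt (2 * pi) ^ DIM('a) * (sqrt (2 * pi) ^ DIM('a) * (\<integral>x. (f x)\<^sup>2 \<partial>lborel)) = (2 * pi) ^ DIM('a) * (\<integral>x. (f x)\<^sup>2 \<partial>lborel)"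
    by (simp only: mult.assoc[symmetric])
  have mono: "mono (\<lambda>k. exp (- ((e k * norm \<xi>)\<^sup>2 / 2)) * fourier_power f \<xi>)" for \<xi> :: 'a
  proof (intro monoI mult_right_mono fourier_power_nonneg)
    fix i j :: nat assume "i \<le> j"
    then have "e j \<le> e i" unfolding e_def by (intro divide_left_mono) auto
    then have "(e j * norm \<xi>)\<^sup>2 \<le> (e i * norm \<xi>)\<^sup>2"
      using e0[of j] by (intro power_mono mult_right_mono) auto
    then show "exp (- ((e i * norm \<xi>)\<^sup>2 / 2)) \<le> exp (- ((e j * norm \<xi>)\<^sup>2 / 2))" by simp
  qed
  have lim: "(\<lambda>k. exp (- ((e k * norm \<xi>)\<^sup>2 / 2)) * fourier_power f \<xi>) \<longlonglongrightarrow> fourier_power f \<xi>" for \<xi> :: 'a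
  proof -
    have "(\<lambda>k. exp (- ((e k * norm \<xi>)\<^sup>2 / 2)) * fourier_power f \<xi>) \<longlonglongrightarrow> exp (- ((0 * norm \<xi>)\<^sup>2 / 2)) * fourier_power f \<xi>"
      by (intro tendsto_intros elim) auto
    then show ?thesis by simp
  qed
  \<comment> \<open>The weights increase to 1 as \<open>e k\<close> decreases. Monotone convergence
    yields the integrability of the limit together with its integral, so square integrability of the
    transform need not be known beforehand.\<close>
  note M = integral_monotone_convergence_nonneg[OF integrable_mult_gaussian_weight[OF f e0] AE_I2[OF mono] AE_I2 AE_I2[OF lim] L[unfolded c]]
  show "integrable lborel (fourier_power f)" by (rule M(1)) (auto simp: fourier_power_nonneg)
  show "integral\<^sup>L lborel (fourier_power f) = (2 * pi) ^ DIM('a) * (\<integral>x. (f x)\<^sup>2 \<partial>lborel)"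
    by (rule M(2)) (auto simp: fourier_power_nonneg)
qed

subsection \<open>Test functions and their transforms\<close>

text \<open>By translation invariance all difference quotients of h have integral zero, and they converge
  boundedly on a compact set.\<close>

lemma integral_directional_derivative_zero:
  fixes h h' :: "'a::euclidean_space \<Rightarrow> real"
  assumes h: "continuous_on UNIV h" and h': "continuous_on UNIV h'"
    and K: "compact K" "\<And>x. x \<notin> K \<Longrightarrow> h x = 0" "\<And>x. x \<notin> K \<Longrightarrow> h' x = 0"
    and D: "\<And>x. ((\<lambda>t. h (x + t *\<^sub>R e)) has_real_derivative h' x) (at 0)"
  shows "integral\<^sup>L lborel h' = 0"
proof -
  have ih: "integrable lborel h" by (rule compact_support_integrable[OF h K(1,2)])
  have ih': "integrable lborel h'" by (rule compact_support_integrable[OF h' K(1,3)])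
  have [measurable]: "h \<in> borel_measurable borel" "h' \<in> borel_measurable borel"
    using ih ih' by (auto dest: borel_measurable_integrable)
  obtain B where B: "B \<ge> 0" "\<And>x. norm (h' x) \<le> B" using compact_support_bounded[OF h' K(1,3)] by blast
  obtain R where R: "\<And>x. x \<in> K \<Longrightarrow> norm x \<le> R"
    using compact_imp_bounded[OF K(1)] by (auto simp: bounded_iff)
  define t :: "nat \<Rightarrow> real" where "t k = inverse (real (Suc k))" for k
  have t: "0 < t k" "t k \<le> 1" for k by (auto simp: t_def divide_simps)
  have tlim: "t \<longlonglongrightarrow> 0" unfolding t_def by (rule LIMSEQ_inverse_real_of_nat)
  let ?q = "\<lambda>k x. (h (x + t k *\<^sub>R e) - h x) / t k"
  \<comment> \<open>All steps satisfy \<open>t k \<le> 1\<close>, so every difference quotient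
    vanishes outside this ball. Inside it the mean value theorem bounds the quotient by
    \<open>B\<close>; this gives one dominating function for all k.\<close>
  let ?C = "cball (0::'a) (R + norm e)"
  have Ds: "((\<lambda>t. h (x + t *\<^sub>R e)) has_real_derivative h' (x + s *\<^sub>R e)) (at s)" for x s
    using D[of "x + s *\<^sub>R e"] DERIV_shift[of "\<lambda>t. h (x + t *\<^sub>R e)" "h' (x + s *\<^sub>R e)" 0 s]
    by (simp add: algebra_simps)
  have bound: "norm (?q k x) \<le> B * indicator ?C x" for k x
  proof (cases "x \<in> ?C")
    case True
    obtain s where "0 < s" "s < t k" "h (x + t k *\<^sub>R e) - h (x + 0 *\<^sub>R e) = (t k - 0) * h' (x + s *\<^sub>R e)"
      using MVT2[OF t(1)[of k], of "\<lambda>t. h (x + t *\<^sub>R e)" "\<lambda>s. h' (x + s *\<^sub>R e)"] Ds by blast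
    then show ?thesis using True B(2)[of "x + s *\<^sub>R e"] t(1)[of k] by simp
  next
    case False
    then have "norm x > R + norm e" by simp
    moreover have "norm x \<le> norm (x + t k *\<^sub>R e) + norm (t k *\<^sub>R e)"
      using norm_triangle_ineq4[of "x + t k *\<^sub>R e" "t k *\<^sub>R e"] by simp
    moreover have "norm (t k *\<^sub>R e) \<le> norm e" using t[of k] by (simp add: mult_left_le_one_le)
    ultimately have "norm x > R" "norm (x + t k *\<^sub>R e) > R" using norm_ge_zero[of e] by linarith+
    then have "x \<notin> K" "x + t k *\<^sub>R e \<notin> K" using R by force+
    then show ?thesis using K(2) B(1) by (simp add: indicator_def)
  qed
  have z: "integral\<^sup>L lborel (?q k) = 0" for k
  proof -
    have "(\<integral>x. h x \<partial>lborel) = (\<integral>x. h (t k *\<^sub>R e + x) \<partial>lborel)"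
      by (subst (1) lborel_distr_plus[symmetric, of "t k *\<^sub>R e"]) (rule integral_distr; simp)
    moreover have "integrable lborel (\<lambda>x. h (t k *\<^sub>R e + x))"
      using ih by (subst (asm) lborel_distr_plus[symmetric, of "t k *\<^sub>R e"]) (simp add: integrable_distr_eq)
    ultimately show ?thesis using ih by (simp add: add.commute)
  qed
  have "(\<lambda>k. integral\<^sup>L lborel (?q k)) \<longlonglongrightarrow> integral\<^sup>L lborel h'"
  proof (rule integral_dominated_convergence[where w="\<lambda>x. B * indicator ?C x"])
    show "integrable lborel (\<lambda>x. B * indicator ?C x)"
      using emeasure_bounded_finite[OF bounded_cball, of "0::'a" "R + norm e"]
      by (auto intro!: integrable_mult_right integrable_real_indicator)
    show "AE x in lborel. (\<lambda>k. ?q k x) \<longlonglongrightarrow> h' x"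
    proof (rule AE_I2)
      fix x
      have "((\<lambda>s. (h (x + s *\<^sub>R e) - h x) / s) \<longlongrightarrow> h' x) (at 0)"
        using D[of x] by (simp add: DERIV_def)
      moreover have "filterlim t (at 0) sequentially"
        using tlim t(1) by (auto simp: filterlim_at intro!: always_eventually) (metis less_irrefl)
      ultimately show "(\<lambda>k. ?q k x) \<longlonglongrightarrow> h' x" by (rule filterlim_compose)
    qed
  qed (use bound in auto)
  then show ?thesis unfolding z by (simp add: LIMSEQ_const_iff)
qed

text \<open>Integration by parts without boundary terms: the derivatives of f times cosine and of f
  times sine have integral zero.\<close>

lemma transform_directional_derivative:
  fixes f f' :: "'a::euclidean_space \<Rightarrow> real"
  assumes f: "continuous_on UNIV f" and f': "continuous_on UNIV f'"
    and K: "compact K" "\<And>x. x \<notin> K \<Longrightarrow> f x = 0" "\<And>x. x \<notin> K \<Longrightarrow> f' x = 0"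
    and D: "\<And>x. ((\<lambda>t. f (x + t *\<^sub>R e)) has_real_derivative f' x) (at 0)"
  shows "cos_transform f' \<xi> = (\<xi> \<bullet> e) * sin_transform f \<xi>"
    and "sin_transform f' \<xi> = - ((\<xi> \<bullet> e) * cos_transform f \<xi>)"
proof -
  have i: "integrable lborel f" "integrable lborel f'"
    by (auto intro: compact_support_integrable[OF f K(1,2)] compact_support_integrable[OF f' K(1,3)])
  have [measurable]: "f \<in> borel_measurable borel" "f' \<in> borel_measurable borel"
    using i by (auto dest: borel_measurable_integrable)
  have ii: "integrable lborel (\<lambda>x. f x * cos (\<xi> \<bullet> x))" "integrable lborel (\<lambda>x. f x * sin (\<xi> \<bullet> x))"
    "integrable lborel (\<lambda>x. f' x * cos (\<xi> \<bullet> x))" "integrable lborel (\<lambda>x. f' x * sin (\<xi> \<bullet> x))"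
    by (auto intro!: integrable_mult_bounded[where B=1] i)
  have "integral\<^sup>L lborel (\<lambda>x. f' x * cos (\<xi> \<bullet> x) - (\<xi> \<bullet> e) * (f x * sin (\<xi> \<bullet> x))) = 0"
    by (rule integral_directional_derivative_zero[where h="\<lambda>x. f x * cos (\<xi> \<bullet> x)" and K=K and e=e])
      (use K in \<open>auto intro!: continuous_intros f f' derivative_eq_intros D simp: inner_add_right\<close>)
  then show "cos_transform f' \<xi> = (\<xi> \<bullet> e) * sin_transform f \<xi>"
    using ii by (simp add: cos_transform_def sin_transform_def)
  have "integral\<^sup>L lborel (\<lambda>x. f' x * sin (\<xi> \<bullet> x) + (\<xi> \<bullet> e) * (f x * cos (\<xi> \<bullet> x))) = 0"
    by (rule integral_directional_derivative_zero[where h="\<lambda>x. f x * sin (\<xi> \<bullet> x)" and K=K and e=e])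
      (use K in \<open>auto intro!: continuous_intros f f' derivative_eq_intros D simp: inner_add_right\<close>)
  then show "sin_transform f' \<xi> = - ((\<xi> \<bullet> e) * cos_transform f \<xi>)"
    using ii by (simp add: cos_transform_def sin_transform_def)
qed

section \<open>Calculus of smooth functions and closure properties of test functions\<close>

lemma DERIV_partial:
  assumes "f differentiable at (x::real^'n::finite)"
  shows "((\<lambda>t. f (x + t *\<^sub>R axis i 1)) has_real_derivative partial i f x) (at 0)"
proof -
  have "(\<lambda>t. f (x + t *\<^sub>R axis i 1)) differentiable at (0::real)"
    using differentiable_chain_at[of "\<lambda>t::real. x + t *\<^sub>R axis i 1" 0 f] assms
    by (simp add: o_def)
  \<comment> \<open>Since \<open>partial\<close> is defined by \<open>deriv\<close>, it is
    meaningful only where the restriction to the line is differentiable, which has just been derived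
    from differentiability of f.\<close>
  then show ?thesis
    unfolding partial_def by (simp add: DERIV_deriv_iff_real_differentiable)
qed

lemma smooth_fun_differentiable: "smooth_fun f \<Longrightarrow> f differentiable at x"
  unfolding smooth_fun_def by (metis partial_iter.simps(1))

text \<open>\<open>partial_iter\<close> applies the head of the list last, so the derivative taken
  first sits at the end. Appending there is what shows that \<open>smooth_fun\<close> is inherited
  by partial derivatives.\<close>

lemma partial_iter_snoc: "partial_iter (is @ [i]) f = partial_iter is (partial i f)"
  by (induction "is") auto

lemma smooth_fun_partial: "smooth_fun f \<Longrightarrow> smooth_fun (partial i f)"
  unfolding smooth_fun_def by (metis partial_iter_snoc)

lemma smooth_fun_partial_iter: "smooth_fun f \<Longrightarrow> smooth_fun (partial_iter is f)"
  by (induction "is") (auto intro: smooth_fun_partial)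

lemma smooth_fun_continuous: "smooth_fun f \<Longrightarrow> continuous_on UNIV f"
  by (simp add: smooth_fun_differentiable differentiable_imp_continuous_within continuous_at_imp_continuous_on)

lemma partial_sum:
  assumes "\<And>j. j \<in> J \<Longrightarrow> f j differentiable at x"
  shows "partial i (\<lambda>x. \<Sum>j\<in>J. c j * f j x) x = (\<Sum>j\<in>J. c j * partial i (f j) x)"
  unfolding partial_def[of i "\<lambda>x. \<Sum>j\<in>J. c j * f j x"]
  by (rule DERIV_imp_deriv) (intro DERIV_sum DERIV_cmult DERIV_partial assms)

lemma partial_iter_sum:
  assumes "\<And>j. j \<in> J \<Longrightarrow> smooth_fun (f j)"
  shows "partial_iter is (\<lambda>x. \<Sum>j\<in>J. c j * f j x) = (\<lambda>x. \<Sum>j\<in>J. c j * partial_iter is (f j) x)"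
proof (induction "is")
  case (Cons i "is")
  then show ?case
    using assms by (auto intro!: partial_sum smooth_fun_differentiable smooth_fun_partial_iter)
qed auto

lemma smooth_fun_sum:
  assumes "finite J" "\<And>j. j \<in> J \<Longrightarrow> smooth_fun (f j)"
  shows "smooth_fun (\<lambda>x. \<Sum>j\<in>J. c j * f j x)"
proof -
  have "(\<lambda>x. \<Sum>j\<in>J. c j * partial_iter is (f j) x) differentiable at x" for "is" x
    using smooth_fun_differentiable[OF smooth_fun_partial_iter[OF assms(2)]]
    by (intro differentiable_sum differentiable_mult assms(1)) auto
  then show ?thesis by (simp add: smooth_fun_def partial_iter_sum[OF assms(2)])
qed

lemma Cc_infI:
  assumes "smooth_fun f" "compact K" "K \<subseteq> \<Omega>" "\<And>x. x \<notin> K \<Longrightarrow> f x = 0"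
  shows "f \<in> Cc_inf \<Omega>"
proof -
  have "closure {x. f x \<noteq> 0} \<subseteq> K"
    using assms by (intro closure_minimal compact_imp_closed) auto
  then show ?thesis
    using assms closure_subset[of "{x. f x \<noteq> 0}"] unfolding Cc_inf_def
    by (auto intro!: bounded_subset[OF compact_imp_bounded[OF assms(2)]])
qed

text \<open>The complement of the closed support is open, so f vanishes near each of its points and
  so do its difference quotients. One compact set thus serves f and all its first partial
  derivatives.\<close>

lemma Cc_infE:
  assumes "f \<in> Cc_inf \<Omega>"
  obtains K where "smooth_fun f" "compact K" "K \<subseteq> \<Omega>" "\<And>x. x \<notin> K \<Longrightarrow> f x = 0" "\<And>i x. x \<notin> K \<Longrightarrow> partial i f x = 0"
proof -
  let ?K = "closure {x. f x \<noteq> 0}"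
  have 0: "f x = 0" if "x \<notin> ?K" for x
    using that closure_subset[of "{x. f x \<noteq> 0}"] by auto
  have "partial i f x = 0" if "x \<notin> ?K" for i x
  proof -
    let ?g = "\<lambda>t::real. x + t *\<^sub>R axis i 1"
    have "open (?g -` (- ?K))"
      by (intro open_vimage continuous_intros) auto
    moreover have "0 \<in> ?g -` (- ?K)" using that by simp
    ultimately have "\<forall>\<^sub>F t in nhds 0. t \<in> ?g -` (- ?K)" by (rule eventually_nhds_in_open)
    then have "\<forall>\<^sub>F t in nhds 0. f (?g t) = 0" by eventually_elim (rule 0, simp only: vimage_eq Compl_iff not_False_eq_True)
    then have "deriv (\<lambda>t. f (?g t)) 0 = deriv (\<lambda>t. 0) 0" by (rule deriv_cong_ev) simp
    then show ?thesis by (simp add: partial_def)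
  qed
  moreover have "smooth_fun f" "compact ?K" "?K \<subseteq> \<Omega>"
    using assms by (auto simp: Cc_inf_def simp del: compact_closure)
  ultimately show thesis
    using 0 by (intro that)
qed

lemma Cc_inf_partial: "f \<in> Cc_inf \<Omega> \<Longrightarrow> partial i f \<in> Cc_inf \<Omega>"
  by (metis Cc_infE Cc_infI smooth_fun_partial)

lemma Cc_inf_sum:
  assumes "finite J" "\<And>j. j \<in> J \<Longrightarrow> f j \<in> Cc_inf \<Omega>"
  shows "(\<lambda>x. \<Sum>j\<in>J. c j * f j x) \<in> Cc_inf \<Omega>"
proof -
  have "\<exists>K. compact K \<and> K \<subseteq> \<Omega> \<and> (\<forall>x. x \<notin> K \<longrightarrow> f j x = 0)" if "j \<in> J" for j
    using assms(2)[OF that] by (metis Cc_infE)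
  then obtain K where K: "\<And>j. j \<in> J \<Longrightarrow> compact (K j) \<and> K j \<subseteq> \<Omega> \<and> (\<forall>x. x \<notin> K j \<longrightarrow> f j x = 0)"
    by metis
  show ?thesis
  proof (rule Cc_infI[of _ "\<Union>j\<in>J. K j"])
    show "smooth_fun (\<lambda>x. \<Sum>j\<in>J. c j * f j x)"
      using assms by (intro smooth_fun_sum) (auto simp: Cc_inf_def)
    show "compact (\<Union>j\<in>J. K j)" using K assms(1) by (intro compact_UN) auto
  qed (use K in \<open>auto intro!: sum.neutral\<close>)
qed

lemma Cc_inf_laplacian: "f \<in> Cc_inf \<Omega> \<Longrightarrow> laplacian f \<in> Cc_inf \<Omega>"
  using Cc_inf_sum[of UNIV "\<lambda>i. partial i (partial i f)" \<Omega> "\<lambda>_. 1"]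
  by (simp add: Cc_inf_partial laplacian_def[abs_def])

lemma grad_sum:
  assumes "\<And>j. j \<in> J \<Longrightarrow> f j \<in> Cc_inf \<Omega>"
  shows "grad (\<lambda>x. \<Sum>j\<in>J. c j * f j x) = (\<lambda>x. \<Sum>j\<in>J. c j *\<^sub>R grad (f j) x)"
  using assms by (auto simp: grad_def vec_eq_iff fun_eq_iff Cc_inf_def intro!: partial_sum smooth_fun_differentiable)

lemma laplacian_sum:
  assumes "\<And>j. j \<in> J \<Longrightarrow> f j \<in> Cc_inf \<Omega>"
  shows "laplacian (\<lambda>x. \<Sum>j\<in>J. c j * f j x) = (\<lambda>x. \<Sum>j\<in>J. c j * laplacian (f j) x)"
proof
  fix x
  have "partial i (partial i (\<lambda>x. \<Sum>j\<in>J. c j * f j x)) x = (\<Sum>j\<in>J. c j * partial i (partial i (f j)) x)" for i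
    using partial_iter_sum[of J f "[i, i]" c] assms by (auto simp: Cc_inf_def fun_eq_iff)
  then show "laplacian (\<lambda>x. \<Sum>j\<in>J. c j * f j x) x = (\<Sum>j\<in>J. c j * laplacian (f j) x)"
    unfolding laplacian_def by (simp add: sum_distrib_left) (rule sum.swap)
qed

lemma Cc_inf_continuous: "f \<in> Cc_inf \<Omega> \<Longrightarrow> continuous_on UNIV f"
  by (simp add: Cc_inf_def smooth_fun_continuous)

lemma Cc_inf_measurable: "f \<in> Cc_inf \<Omega> \<Longrightarrow> f \<in> borel_measurable borel"
  by (intro borel_measurable_continuous_onI Cc_inf_continuous)

lemma Cc_inf_integrable: "f \<in> Cc_inf \<Omega> \<Longrightarrow> integrable lborel f"
  by (metis Cc_infE Cc_inf_continuous compact_support_integrable)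

lemma Cc_inf_bounded:
  assumes "f \<in> Cc_inf \<Omega>"
  obtains B where "B \<ge> 0" "\<And>x. \<bar>f x\<bar> \<le> B"
  using compact_support_bounded[OF Cc_inf_continuous[OF assms]] assms
  by (metis Cc_infE real_norm_def)

lemma Cc_inf_zero: "f \<in> Cc_inf \<Omega> \<Longrightarrow> x \<notin> \<Omega> \<Longrightarrow> f x = 0"
  by (metis Cc_infE subsetD)

lemma grad_continuous: "f \<in> Cc_inf \<Omega> \<Longrightarrow> continuous_on UNIV (grad f)"
  unfolding grad_def[abs_def] by (intro continuous_on_vec_lambda Cc_inf_continuous Cc_inf_partial)

lemma grad_zero: "f \<in> Cc_inf \<Omega> \<Longrightarrow> x \<notin> \<Omega> \<Longrightarrow> grad f x = 0"
  by (simp add: grad_def vec_eq_iff Cc_inf_zero[OF Cc_inf_partial])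

section \<open>Differentiation as multiplication on the Fourier side, and Plancherel for gradient
  and Laplacian\<close>

lemma transform_partial:
  assumes "f \<in> Cc_inf \<Omega>"
  shows "cos_transform (partial i f) \<xi> = \<xi> $ i * sin_transform f \<xi>"
    and "sin_transform (partial i f) \<xi> = - (\<xi> $ i * cos_transform f \<xi>)"
proof -
  obtain K where K: "smooth_fun f" "compact K" "\<And>x. x \<notin> K \<Longrightarrow> f x = 0" "\<And>i x. x \<notin> K \<Longrightarrow> partial i f x = 0"
    using assms by (auto elim: Cc_infE)
  note T = transform_directional_derivative[OF Cc_inf_continuous[OF assms]
      Cc_inf_continuous[OF Cc_inf_partial[OF assms]] K(2,3,4) DERIV_partial[OF smooth_fun_differentiable[OF K(1)]], of i]
  show "cos_transform (partial i f) \<xi> = \<xi> $ i * sin_transform f \<xi>" using T(1) by (simp add: inner_axis)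
  show "sin_transform (partial i f) \<xi> = - (\<xi> $ i * cos_transform f \<xi>)" using T(2) by (simp add: inner_axis)
qed

lemma transform_laplacian:
  fixes f :: "real^'n::finite \<Rightarrow> real"
  assumes "f \<in> Cc_inf \<Omega>"
  shows "cos_transform (laplacian f) \<xi> = - ((norm \<xi>)\<^sup>2 * cos_transform f \<xi>)"
    and "sin_transform (laplacian f) \<xi> = - ((norm \<xi>)\<^sup>2 * sin_transform f \<xi>)"
proof -
  have n: "(norm \<xi>)\<^sup>2 = (\<Sum>i\<in>UNIV. (\<xi> $ i)\<^sup>2)"
    unfolding power2_norm_eq_inner inner_vec_def by (simp add: power2_eq_square)
  have pp: "partial i (partial i f) \<in> Cc_inf \<Omega>" for i using assms by (intro Cc_inf_partial)
  have [measurable]: "partial i (partial i f) \<in> borel_measurable borel" for i by (rule Cc_inf_measurable[OF pp])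
  have "cos_transform (laplacian f) \<xi> = (\<Sum>i\<in>UNIV. cos_transform (partial i (partial i f)) \<xi>)"
    unfolding cos_transform_def laplacian_def sum_distrib_right
    by (intro Bochner_Integration.integral_sum integrable_mult_bounded[where B=1] Cc_inf_integrable[OF pp]) auto
  then show "cos_transform (laplacian f) \<xi> = - ((norm \<xi>)\<^sup>2 * cos_transform f \<xi>)"
    unfolding transform_partial[OF Cc_inf_partial[OF assms]] transform_partial[OF assms] n
    by (simp add: sum_distrib_right power2_eq_square sum_negf mult.assoc)
  have "sin_transform (laplacian f) \<xi> = (\<Sum>i\<in>UNIV. sin_transform (partial i (partial i f)) \<xi>)"
    unfolding sin_transform_def laplacian_def sum_distrib_right
    by (intro Bochner_Integration.integral_sum integrable_mult_bounded[where B=1] Cc_inf_integrable[OF pp]) auto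
  then show "sin_transform (laplacian f) \<xi> = - ((norm \<xi>)\<^sup>2 * sin_transform f \<xi>)"
    unfolding transform_partial[OF Cc_inf_partial[OF assms]] transform_partial[OF assms] n
    by (simp add: sum_distrib_right power2_eq_square sum_negf mult.assoc)
qed

lemma Cc_inf_plancherel:
  fixes f :: "real^'n::finite \<Rightarrow> real"
  assumes "f \<in> Cc_inf \<Omega>"
  shows "has_bochner_integral lborel (fourier_power f) ((2 * pi) ^ CARD('n) * (\<integral>x. (f x)\<^sup>2 \<partial>lborel))"
proof -
  obtain K where K: "compact K" "\<And>x. x \<notin> K \<Longrightarrow> f x = 0" using assms by (auto elim: Cc_infE)
  show ?thesis
    using plancherel[OF Cc_inf_continuous[OF assms] K] by (simp add: has_bochner_integral_iff)
qed

lemma Cc_inf_power2_integrable: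
  assumes "f \<in> Cc_inf \<Omega>" shows "integrable lborel (\<lambda>x. (f x)\<^sup>2)"
proof -
  obtain B where "\<And>x. \<bar>f x\<bar> \<le> B" using Cc_inf_bounded[OF assms] by metis
  then show ?thesis
    unfolding power2_eq_square
    by (intro integrable_mult_bounded[where B=B] Cc_inf_integrable[OF assms]) (use Cc_inf_measurable[OF assms] in auto)
qed

text \<open>Plancherel for each partial derivative: differentiation in direction i swaps the cosine
  and sine transforms up to sign and multiplies by the i-th coordinate of \<xi>, and the squares of
  the coordinates add up to |\<xi>|^2.\<close>

lemma grad_plancherel:
  fixes f :: "real^'n::finite \<Rightarrow> real"
  assumes "f \<in> Cc_inf \<Omega>"
  shows "has_bochner_integral lborel (\<lambda>\<xi>. (norm \<xi>)\<^sup>2 * fourier_power f \<xi>)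
    ((2 * pi) ^ CARD('n) * (\<integral>x. (norm (grad f x))\<^sup>2 \<partial>lborel))"
proof -
  have n: "(norm \<xi>)\<^sup>2 = (\<Sum>i\<in>UNIV. (\<xi> $ i)\<^sup>2)" for \<xi> :: "real^'n"
    unfolding power2_norm_eq_inner inner_vec_def by (simp add: power2_eq_square)
  have "has_bochner_integral lborel (\<lambda>\<xi>. \<Sum>i\<in>UNIV. fourier_power (partial i f) \<xi>)
     (\<Sum>i\<in>UNIV. (2 * pi) ^ CARD('n) * (\<integral>x. (partial i f x)\<^sup>2 \<partial>lborel))"
    by (intro has_bochner_integral_sum Cc_inf_plancherel[OF Cc_inf_partial[OF assms]])
  also have "(\<lambda>\<xi>. \<Sum>i\<in>UNIV. fourier_power (partial i f) \<xi>) = (\<lambda>\<xi>. (norm \<xi>)\<^sup>2 * fourier_power f \<xi>)"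
    unfolding n sum_distrib_right
    by (auto simp: fourier_power_def transform_partial[OF assms] power_mult_distrib algebra_simps intro!: sum.cong)
  also have "(\<Sum>i\<in>UNIV. (2 * pi) ^ CARD('n) * (\<integral>x. (partial i f x)\<^sup>2 \<partial>lborel))
     = (2 * pi) ^ CARD('n) * (\<integral>x. (norm (grad f x))\<^sup>2 \<partial>lborel)"
    unfolding n grad_def using Cc_inf_power2_integrable[OF Cc_inf_partial[OF assms]]
    by (simp add: sum_distrib_left)
  finally show ?thesis .
qed

lemma laplacian_plancherel:
  fixes f :: "real^'n::finite \<Rightarrow> real"
  assumes "f \<in> Cc_inf \<Omega>"
  shows "has_bochner_integral lborel (\<lambda>\<xi>. (norm \<xi>) ^ 4 * fourier_power f \<xi>)
    ((2 * pi) ^ CARD('n) * (\<integral>x. (laplacian f x)\<^sup>2 \<partial>lborel))"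
proof -
  have "fourier_power (laplacian f) = (\<lambda>\<xi>. (norm \<xi>) ^ 4 * fourier_power f \<xi>)"
    by (auto simp: fourier_power_def transform_laplacian[OF assms] power_mult_distrib algebra_simps)
  then show ?thesis using Cc_inf_plancherel[OF Cc_inf_laplacian[OF assms]] by simp
qed

subsection \<open>Bessel's inequality and the Riesz mean of test functions\<close>

lemma has_bochner_integral_mono:
  fixes f g :: "'a \<Rightarrow> real"
  assumes "has_bochner_integral M f a" "has_bochner_integral M g b" "\<And>x. f x \<le> g x"
  shows "a \<le> b"
  using assms integral_mono[of M f g] by (auto simp: has_bochner_integral_iff)

text \<open>The integrand is the length of the interval from |\<xi>|^2 to z. After exchanging the
  order of integration, the slice at height s is a ball of radius \<open>sqrt s\<close> and volume
  B_d s^(d/2). Integrating this from 0 to z divides by d/2 + 1, which is the origin of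
  2/(d+2).\<close>

lemma integral_max_diff_norm_power2:
  fixes z :: real
  assumes z: "z \<ge> 0"
  shows "has_bochner_integral lborel (\<lambda>\<xi>::'a::euclidean_space. max (z - (norm \<xi>)\<^sup>2) 0)
    (2 / (real DIM('a) + 2) * unit_ball_vol DIM('a) * z powr (1 + real DIM('a) / 2))" (is "has_bochner_integral _ ?f ?I")
proof (rule has_bochner_integral_nn_integral)
  have d: "real DIM('a) / 2 > -1" "real DIM('a) / 2 + 1 > 0" using DIM_positive[where 'a='a] by linarith+
  have "(\<integral>\<^sup>+\<xi>. ennreal (?f \<xi>) \<partial>lborel) = (\<integral>\<^sup>+\<xi>. (\<integral>\<^sup>+s. indicator {p. (norm (fst p))\<^sup>2 < snd p \<and> snd p < z} (\<xi>::'a, s) \<partial>lborel) \<partial>lborel)"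
  proof (rule nn_integral_cong)
    fix \<xi> :: 'a
    have "(\<integral>\<^sup>+s. indicator {p. (norm (fst p))\<^sup>2 < snd p \<and> snd p < z} (\<xi>, s) \<partial>lborel) = (\<integral>\<^sup>+s. indicator {(norm \<xi>)\<^sup>2<..<z} s \<partial>lborel)"
      by (intro nn_integral_cong) (auto simp: indicator_def)
    also have "\<dots> = ennreal (?f \<xi>)"
      by (auto simp: max_def)
    finally show "ennreal (?f \<xi>) = (\<integral>\<^sup>+s. indicator {p. (norm (fst p))\<^sup>2 < snd p \<and> snd p < z} (\<xi>, s) \<partial>lborel)" ..
  qed
  also have "\<dots> = (\<integral>\<^sup>+s. (\<integral>\<^sup>+\<xi>. indicator {p. (norm (fst p))\<^sup>2 < snd p \<and> snd p < z} (\<xi>::'a, s) \<partial>lborel) \<partial>lborel)"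
    by (rule lborel_pair.Fubini'[symmetric]) measurable
  also have "\<dots> = (\<integral>\<^sup>+s. ennreal (indicator {0..z} s * (unit_ball_vol DIM('a) * s powr (real DIM('a) / 2))) \<partial>lborel)"
  proof (rule nn_integral_cong_AE)
    \<comment> \<open>The slice at \<open>s = z\<close> is empty although z belongs to the closed
      interval of integration. At the other end both sides vanish, because
      \<open>0 powr (real DIM('a) / 2)\<close> is 0.\<close>
    have "AE s in lborel. s \<noteq> z" by (rule AE_lborel_singleton)
    then show "AE s in lborel. (\<integral>\<^sup>+\<xi>. indicator {p. (norm (fst p))\<^sup>2 < snd p \<and> snd p < z} (\<xi>::'a, s) \<partial>lborel)
       = ennreal (indicator {0..z} s * (unit_ball_vol DIM('a) * s powr (real DIM('a) / 2)))"
    proof (rule AE_mp[OF _ AE_I2], safe)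
      fix s :: real
      assume sz: "s \<noteq> z"
      show "(\<integral>\<^sup>+\<xi>. indicator {p. (norm (fst p))\<^sup>2 < snd p \<and> snd p < z} (\<xi>::'a, s) \<partial>lborel)
       = ennreal (indicator {0..z} s * (unit_ball_vol DIM('a) * s powr (real DIM('a) / 2)))"
      proof (cases "0 < s \<and> s < z")
        case True
        have iff: "(norm \<xi>)\<^sup>2 < s \<longleftrightarrow> norm \<xi> < sqrt s" for \<xi> :: 'a
          using True by (metis abs_norm_cancel real_less_rsqrt real_sqrt_abs real_sqrt_less_iff)
        have "(\<integral>\<^sup>+\<xi>. indicator {p. (norm (fst p))\<^sup>2 < snd p \<and> snd p < z} (\<xi>::'a, s) \<partial>lborel) = (\<integral>\<^sup>+\<xi>. indicator (ball (0::'a) (sqrt s)) \<xi> \<partial>lborel)"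
          using True by (intro nn_integral_cong) (auto simp: indicator_def iff)
        also have "\<dots> = ennreal (unit_ball_vol DIM('a) * sqrt s ^ DIM('a))"
          using True by (simp add: emeasure_ball)
        also have "sqrt s ^ DIM('a) = s powr (real DIM('a) / 2)"
          using True by (simp add: powr_half_sqrt[symmetric] powr_powr powr_realpow[symmetric])
        finally show ?thesis using True by simp
      next
        case False
        have "\<not> ((norm \<xi>)\<^sup>2 < s \<and> s < z)" for \<xi> :: 'a using False zero_le_power2[of "norm \<xi>"] by linarith
        then have "(\<integral>\<^sup>+\<xi>. indicator {p. (norm (fst p))\<^sup>2 < snd p \<and> snd p < z} (\<xi>::'a, s) \<partial>lborel) = 0"
          by simp
        then show ?thesis using False sz by (auto simp: indicator_def)
      qed
    qed
  qed
  also have "\<dots> = ennreal (unit_ball_vol DIM('a) * (z powr (real DIM('a) / 2 + 1) / (real DIM('a) / 2 + 1)))"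
    by (rule nn_integral_has_integral_lebesgue)
      (use d z has_integral_mult_right[OF has_integral_powr_from_0] in auto)
  also have "unit_ball_vol DIM('a) * (z powr (real DIM('a) / 2 + 1) / (real DIM('a) / 2 + 1)) = ?I"
    using d by (simp add: field_simps)
  finally show "(\<integral>\<^sup>+\<xi>. ennreal (?f \<xi>) \<partial>lborel) = ennreal ?I" .
qed auto

section \<open>Square-integrable functions and vector fields, and an approximate Bessel
  inequality\<close>

definition square_integrable :: "'a measure \<Rightarrow> ('a \<Rightarrow> 'b::euclidean_space) \<Rightarrow> bool" where
  "square_integrable M u \<longleftrightarrow> u \<in> borel_measurable M \<and> integrable M (\<lambda>x. (norm (u x))\<^sup>2)"

lemma square_integrable_inner:
  assumes "square_integrable M u" "square_integrable M v"
  shows "integrable M (\<lambda>x. u x \<bullet> v x)"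
proof (rule Bochner_Integration.integrable_bound)
  show "integrable M (\<lambda>x. (norm (u x))\<^sup>2 + (norm (v x))\<^sup>2)"
    using assms by (auto simp: square_integrable_def)
  show "AE x in M. norm (u x \<bullet> v x) \<le> norm ((norm (u x))\<^sup>2 + (norm (v x))\<^sup>2)"
  proof (rule AE_I2)
    fix x
    have "\<bar>u x \<bullet> v x\<bar> \<le> norm (u x) * norm (v x)" by (rule Cauchy_Schwarz_ineq2)
    also have "\<dots> \<le> (norm (u x))\<^sup>2 + (norm (v x))\<^sup>2"
      using sum_squares_bound[of "norm (u x)" "norm (v x)"] mult_nonneg_nonneg[OF norm_ge_zero norm_ge_zero, of "u x" "v x"]
      by linarith
    finally show "norm (u x \<bullet> v x) \<le> norm ((norm (u x))\<^sup>2 + (norm (v x))\<^sup>2)" by simp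
  qed
qed (use assms in \<open>auto simp: square_integrable_def\<close>)

lemma square_integrable_add:
  assumes "square_integrable M u" "square_integrable M v"
  shows "square_integrable M (\<lambda>x. u x + v x)"
proof -
  have "(norm (u x + v x))\<^sup>2 = (norm (u x))\<^sup>2 + 2 * (u x \<bullet> v x) + (norm (v x))\<^sup>2" for x
    by (simp add: power2_norm_eq_inner inner_add_left inner_add_right inner_commute)
  then show ?thesis
    using assms square_integrable_inner[OF assms] by (auto simp: square_integrable_def)
qed

lemma square_integrable_scaleR:
  "square_integrable M u \<Longrightarrow> square_integrable M (\<lambda>x. c *\<^sub>R u x)"
  by (auto simp: square_integrable_def power_mult_distrib)

lemma square_integrable_diff:
  "square_integrable M u \<Longrightarrow> square_integrable M v \<Longrightarrow> square_integrable M (\<lambda>x. u x - v x)"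
  using square_integrable_add[of M u "\<lambda>x. (-1) *\<^sub>R v x"] square_integrable_scaleR[of M v "-1"] by simp

lemma square_integrable_sum:
  "finite J \<Longrightarrow> (\<And>j. j \<in> J \<Longrightarrow> square_integrable M (u j)) \<Longrightarrow> square_integrable M (\<lambda>x. \<Sum>j\<in>J. c j *\<^sub>R u j x)"
proof (induction J rule: finite_induct)
  case empty
  then show ?case by (simp add: square_integrable_def)
next
  case (insert j J)
  then show ?case by (simp add: square_integrable_add square_integrable_scaleR)
qed

lemma integral_inner_sum_left:
  assumes "\<And>j. j \<in> J \<Longrightarrow> square_integrable M (u j)" "square_integrable M v"
  shows "(\<integral>x. (\<Sum>j\<in>J. c j *\<^sub>R u j x) \<bullet> v x \<partial>M) = (\<Sum>j\<in>J. c j * (\<integral>x. u j x \<bullet> v x \<partial>M))"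
  using square_integrable_inner[OF assms] by (simp add: inner_sum_left)

lemma integral_inner_sums:
  assumes "finite J" "\<And>j. j \<in> J \<Longrightarrow> square_integrable M (u j)"
    and "finite J'" "\<And>j. j \<in> J' \<Longrightarrow> square_integrable M (v j)"
  shows "(\<integral>x. (\<Sum>j\<in>J. c j *\<^sub>R u j x) \<bullet> (\<Sum>k\<in>J'. d k *\<^sub>R v k x) \<partial>M) = (\<Sum>j\<in>J. \<Sum>k\<in>J'. c j * d k * (\<integral>x. u j x \<bullet> v k x \<partial>M))"
proof -
  have "(\<integral>x. u j x \<bullet> (\<Sum>k\<in>J'. d k *\<^sub>R v k x) \<partial>M) = (\<Sum>k\<in>J'. d k * (\<integral>x. u j x \<bullet> v k x \<partial>M))" if "j \<in> J" for j
    using integral_inner_sum_left[OF assms(4) assms(2)[OF that]] by (simp add: inner_commute)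
  then show ?thesis
    using assms by (simp add: integral_inner_sum_left square_integrable_sum sum_distrib_left mult.assoc)
qed

text \<open>With U the sum of the \<open>u j\<close> weighted by their inner products with E, and S
  the sum of the squares of these, expanding the squared norm of E - U / L gives ||E||^2 - 2 S / L +
  ||U||^2 / L^2, and \<open>gram\<close> says ||U||^2 \<le> L S. The factor \<open>1 / L\<close> is
  the one that optimises this estimate. For orthonormal \<open>u j\<close> it is Bessel's inequality
  with L = 1; for a single u and L = ||u||^2 it is Cauchy-Schwarz, and it is used below in that form
  too.\<close>

lemma approximate_bessel:
  assumes J: "finite J" and u: "\<And>j. j \<in> J \<Longrightarrow> square_integrable M (u j)" and E: "square_integrable M E"
    and L: "L > 0"
    and gram: "(\<Sum>j\<in>J. \<Sum>k\<in>J. (\<integral>x. u j x \<bullet> E x \<partial>M) * (\<integral>x. u k x \<bullet> E x \<partial>M) * (\<integral>x. u j x \<bullet> u k x \<partial>M))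
       \<le> L * (\<Sum>j\<in>J. (\<integral>x. u j x \<bullet> E x \<partial>M)\<^sup>2)"
  shows "(\<Sum>j\<in>J. (\<integral>x. u j x \<bullet> E x \<partial>M)\<^sup>2) \<le> L * (\<integral>x. (norm (E x))\<^sup>2 \<partial>M)"
proof -
  define a where "a j = (\<integral>x. u j x \<bullet> E x \<partial>M)" for j
  define S where "S = (\<Sum>j\<in>J. (a j)\<^sup>2)"
  define U where "U x = (\<Sum>j\<in>J. a j *\<^sub>R u j x)" for x
  have U: "square_integrable M U" unfolding U_def using J u by (rule square_integrable_sum)
  have UE: "(\<integral>x. U x \<bullet> E x \<partial>M) = S"
    unfolding U_def S_def using integral_inner_sum_left[OF u E] by (simp add: a_def power2_eq_square)
  have UU: "(\<integral>x. U x \<bullet> U x \<partial>M) \<le> L * S"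
    unfolding U_def S_def using integral_inner_sums[OF J u J u, where c=a and d=a] gram by (simp add: a_def)
  have n: "(norm (E x - (1 / L) *\<^sub>R U x))\<^sup>2 = (norm (E x))\<^sup>2 - 2 / L * (U x \<bullet> E x) + 1 / L\<^sup>2 * (U x \<bullet> U x)" for x
    unfolding power2_norm_eq_inner by (simp add: inner_diff_left inner_diff_right inner_commute power2_eq_square)
  have "0 \<le> (\<integral>x. (norm (E x - (1 / L) *\<^sub>R U x))\<^sup>2 \<partial>M)" by simp
  also have "\<dots> = (\<integral>x. (norm (E x))\<^sup>2 \<partial>M) - 2 / L * S + 1 / L\<^sup>2 * (\<integral>x. U x \<bullet> U x \<partial>M)"
    unfolding n UE[symmetric]
    using E square_integrable_inner[OF U E] square_integrable_inner[OF U U] by (simp add: square_integrable_def)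
  also have "\<dots> \<le> (\<integral>x. (norm (E x))\<^sup>2 \<partial>M) - 2 / L * S + 1 / L\<^sup>2 * (L * S)"
    using UU by (intro add_left_mono mult_left_mono) auto
  also have "\<dots> = (\<integral>x. (norm (E x))\<^sup>2 \<partial>M) - S / L"
    using L by (simp add: field_simps power2_eq_square)
  finally have "S / L \<le> (\<integral>x. (norm (E x))\<^sup>2 \<partial>M)" by simp
  then show ?thesis using L unfolding S_def a_def by (simp add: field_simps)
qed

section \<open>Bessel's inequality for gradients of test functions against plane waves\<close>

lemma Cc_inf_square_integrable: "f \<in> Cc_inf \<Omega> \<Longrightarrow> square_integrable lborel f"
  by (simp add: square_integrable_def Cc_inf_measurable Cc_inf_power2_integrable)

lemma grad_measurable: "f \<in> Cc_inf \<Omega> \<Longrightarrow> grad f \<in> borel_measurable borel"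
  by (intro borel_measurable_continuous_onI grad_continuous)

lemma grad_square_integrable: 
  assumes "f \<in> Cc_inf \<Omega>" shows "square_integrable lborel (grad f)"
proof -
  have "(norm (grad f x))\<^sup>2 = (\<Sum>i\<in>UNIV. (partial i f x)\<^sup>2)" for x
    unfolding power2_norm_eq_inner inner_vec_def grad_def by (simp add: power2_eq_square)
  then show ?thesis
    using Cc_inf_power2_integrable[OF Cc_inf_partial[OF assms]]
    by (simp add: square_integrable_def grad_measurable[OF assms])
qed

text \<open>A plane wave is not square integrable on the whole space. Cutting it off to a set of
  finite measure makes it an admissible E in Bessel's inequality, and does not change its inner
  products with fields that vanish outside \<Omega>.\<close>

lemma square_integrable_cutoff:
  fixes v :: "'b::euclidean_space" and g :: "'a::euclidean_space \<Rightarrow> real"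
  assumes "\<Omega> \<in> sets borel" "emeasure lborel \<Omega> < \<infinity>"
    and [measurable]: "g \<in> borel_measurable borel" and "\<And>x. \<bar>g x\<bar> \<le> 1"
  shows "square_integrable lborel (\<lambda>x. (indicator \<Omega> x * g x) *\<^sub>R v)"
proof -
  have [measurable]: "\<Omega> \<in> sets borel" by fact
  have "integrable lborel (\<lambda>x. indicator \<Omega> x * ((g x)\<^sup>2 * (norm v)\<^sup>2))"
  proof (rule integrable_mult_bounded)
    show "\<bar>(g x)\<^sup>2 * (norm v)\<^sup>2\<bar> \<le> (norm v)\<^sup>2" for x
      using assms(4)[of x] by (simp add: abs_mult mult_left_le_one_le abs_square_le_1)
  qed (use assms in \<open>auto intro!: integrable_real_indicator\<close>)
  moreover have "(norm ((indicator \<Omega> x * g x) *\<^sub>R v))\<^sup>2 = indicator \<Omega> x * ((g x)\<^sup>2 * (norm v)\<^sup>2)" for x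
    by (simp add: power_mult_distrib indicator_def)
  ultimately show ?thesis by (simp add: square_integrable_def)
qed

text \<open>Each partial derivative contributes a coordinate of \<xi>, and pairing with the
  direction \<open>sgn \<xi>\<close> turns these into
  \<open>sgn \<xi> \<bullet> \<xi> = norm \<xi>\<close>. This remains correct at \<xi> = 0, where
  \<open>sgn \<xi>\<close> is 0.\<close>

lemma transform_grad:
  fixes f :: "real^'n::finite \<Rightarrow> real"
  assumes f: "f \<in> Cc_inf \<Omega>"
  shows "(\<integral>x. grad f x \<bullet> ((indicator \<Omega> x * cos (\<xi> \<bullet> x)) *\<^sub>R sgn \<xi>) \<partial>lborel) = norm \<xi> * sin_transform f \<xi>"
    and "(\<integral>x. grad f x \<bullet> ((indicator \<Omega> x * sin (\<xi> \<bullet> x)) *\<^sub>R sgn \<xi>) \<partial>lborel) = - (norm \<xi> * cos_transform f \<xi>)"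
proof -
  have s: "(\<Sum>i\<in>UNIV. sgn \<xi> $ i * \<xi> $ i) = norm \<xi>"
  proof -
    have "(\<Sum>i\<in>UNIV. sgn \<xi> $ i * \<xi> $ i) = sgn \<xi> \<bullet> \<xi>" by (simp add: inner_vec_def)
    also have "\<dots> = norm \<xi>" by (cases "\<xi> = 0") (simp_all add: sgn_div_norm dot_square_norm power2_eq_square)
    finally show ?thesis .
  qed
  have eq: "grad f x \<bullet> ((indicator \<Omega> x * c) *\<^sub>R sgn \<xi>) = (\<Sum>i\<in>UNIV. sgn \<xi> $ i * (partial i f x * c))" for x and c :: real
    using grad_zero[OF f, of x]
    by (cases "x \<in> \<Omega>") (auto simp: inner_vec_def grad_def sum_distrib_left vec_eq_iff mult_ac)
  have [measurable]: "partial i f \<in> borel_measurable borel" for i by (rule Cc_inf_measurable[OF Cc_inf_partial[OF f]])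
  have i: "integrable lborel (\<lambda>x. partial i f x * cos (\<xi> \<bullet> x))" "integrable lborel (\<lambda>x. partial i f x * sin (\<xi> \<bullet> x))" for i
    by (auto intro!: integrable_mult_bounded[where B=1] Cc_inf_integrable[OF Cc_inf_partial[OF f]])
  have "(\<integral>x. grad f x \<bullet> ((indicator \<Omega> x * cos (\<xi> \<bullet> x)) *\<^sub>R sgn \<xi>) \<partial>lborel) = (\<Sum>i\<in>UNIV. sgn \<xi> $ i * cos_transform (partial i f) \<xi>)"
    unfolding eq cos_transform_def using i by simp
  then show "(\<integral>x. grad f x \<bullet> ((indicator \<Omega> x * cos (\<xi> \<bullet> x)) *\<^sub>R sgn \<xi>) \<partial>lborel) = norm \<xi> * sin_transform f \<xi>"
    by (simp add: transform_partial[OF f] s sum_distrib_right[symmetric] mult.assoc[symmetric])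
  have "(\<integral>x. grad f x \<bullet> ((indicator \<Omega> x * sin (\<xi> \<bullet> x)) *\<^sub>R sgn \<xi>) \<partial>lborel) = (\<Sum>i\<in>UNIV. sgn \<xi> $ i * sin_transform (partial i f) \<xi>)"
    unfolding eq sin_transform_def using i by simp
  then show "(\<integral>x. grad f x \<bullet> ((indicator \<Omega> x * sin (\<xi> \<bullet> x)) *\<^sub>R sgn \<xi>) \<partial>lborel) = - (norm \<xi> * cos_transform f \<xi>)"
    by (simp add: transform_partial[OF f] s sum_distrib_right[symmetric] mult.assoc[symmetric] sum_negf)
qed

text \<open>The squares of cosine and sine add up to 1, so the two parts of a plane wave share a
  single |\<Omega>| between them. The assumption on v is an inequality so that it also covers
  \<open>sgn 0 = 0\<close>.\<close>

lemma cos_sin_cutoff_le: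
  fixes v :: "'b::euclidean_space" and \<xi> :: "'a::euclidean_space"
  assumes \<Omega>: "\<Omega> \<in> sets borel" "emeasure lborel \<Omega> < \<infinity>" and v: "norm v \<le> 1"
  shows "(\<integral>x. (norm ((indicator \<Omega> x * cos (\<xi> \<bullet> x)) *\<^sub>R v))\<^sup>2 \<partial>lborel) + (\<integral>x. (norm ((indicator \<Omega> x * sin (\<xi> \<bullet> x)) *\<^sub>R v))\<^sup>2 \<partial>lborel)
     \<le> measure lborel \<Omega>"
proof -
  have i: "integrable lborel (\<lambda>x. (norm ((indicator \<Omega> x * cos (\<xi> \<bullet> x)) *\<^sub>R v))\<^sup>2)"
    "integrable lborel (\<lambda>x. (norm ((indicator \<Omega> x * sin (\<xi> \<bullet> x)) *\<^sub>R v))\<^sup>2)"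
    using square_integrable_cutoff[OF \<Omega>, of "\<lambda>x. cos (\<xi> \<bullet> x)" v] square_integrable_cutoff[OF \<Omega>, of "\<lambda>x. sin (\<xi> \<bullet> x)" v]
    by (auto simp: square_integrable_def)
  have le: "(norm ((indicator \<Omega> x * cos (\<xi> \<bullet> x)) *\<^sub>R v))\<^sup>2 + (norm ((indicator \<Omega> x * sin (\<xi> \<bullet> x)) *\<^sub>R v))\<^sup>2 \<le> indicator \<Omega> x" for x
  proof -
    have "(norm ((indicator \<Omega> x * cos (\<xi> \<bullet> x)) *\<^sub>R v))\<^sup>2 + (norm ((indicator \<Omega> x * sin (\<xi> \<bullet> x)) *\<^sub>R v))\<^sup>2
       = indicator \<Omega> x * (((cos (\<xi> \<bullet> x))\<^sup>2 + (sin (\<xi> \<bullet> x))\<^sup>2) * (norm v)\<^sup>2)"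
      unfolding distrib_right by (simp add: power_mult_distrib indicator_def)
    also have "\<dots> = indicator \<Omega> x * (norm v)\<^sup>2" by simp
    also have "\<dots> \<le> indicator \<Omega> x * 1" using v by (intro mult_left_mono) (auto simp: power_le_one)
    finally show ?thesis by simp
  qed
  have "(\<integral>x. (norm ((indicator \<Omega> x * cos (\<xi> \<bullet> x)) *\<^sub>R v))\<^sup>2 + (norm ((indicator \<Omega> x * sin (\<xi> \<bullet> x)) *\<^sub>R v))\<^sup>2 \<partial>lborel)
     \<le> (\<integral>x. indicator \<Omega> x \<partial>lborel)"
    using le by (intro integral_mono Bochner_Integration.integrable_add i) (use \<Omega> in \<open>auto intro!: integrable_real_indicator\<close>)
  then show ?thesis using i \<Omega> by simp
qed

text \<open>Real and imaginary part of the plane wave are inserted separately into the approximate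
  Bessel inequality. Nothing is lost by the splitting, since their squared norms together are at
  most |\<Omega>|. The hypothesis \<open>gram\<close> bounds the largest eigenvalue of the Gram
  matrix of the gradients by L.\<close>

lemma sum_fourier_power_le:
  fixes f :: "'j \<Rightarrow> real^'n::finite \<Rightarrow> real"
  assumes \<Omega>: "\<Omega> \<in> sets borel" "emeasure lborel \<Omega> < \<infinity>"
    and J: "finite J" "\<And>j. j \<in> J \<Longrightarrow> f j \<in> Cc_inf \<Omega>" and L: "L > 0"
    and gram: "\<And>a. (\<Sum>j\<in>J. \<Sum>k\<in>J. a j * a k * (\<integral>x. grad (f j) x \<bullet> grad (f k) x \<partial>lborel)) \<le> L * (\<Sum>j\<in>J. (a j)\<^sup>2)"
  shows "(\<Sum>j\<in>J. (norm \<xi>)\<^sup>2 * fourier_power (f j) \<xi>) \<le> L * measure lborel \<Omega>"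
proof -
  let ?E = "\<lambda>h x. (indicator \<Omega> x * h (\<xi> \<bullet> x)) *\<^sub>R sgn \<xi> :: real^'n"
  have sq: "square_integrable lborel (?E cos)" "square_integrable lborel (?E sin)"
    by (auto intro!: square_integrable_cutoff \<Omega>)
  have B: "(\<Sum>j\<in>J. (\<integral>x. grad (f j) x \<bullet> E x \<partial>lborel)\<^sup>2) \<le> L * (\<integral>x. (norm (E x))\<^sup>2 \<partial>lborel)"
    if "square_integrable lborel E" for E
    by (rule approximate_bessel) (use J L that grad_square_integrable gram in auto)
  have "(\<Sum>j\<in>J. (norm \<xi>)\<^sup>2 * fourier_power (f j) \<xi>)
     = (\<Sum>j\<in>J. (\<integral>x. grad (f j) x \<bullet> ?E cos x \<partial>lborel)\<^sup>2) + (\<Sum>j\<in>J. (\<integral>x. grad (f j) x \<bullet> ?E sin x \<partial>lborel)\<^sup>2)"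
    unfolding sum.distrib[symmetric]
    by (intro sum.cong refl) (simp only: transform_grad[OF J(2)] fourier_power_def power2_minus power_mult_distrib distrib_left add.commute)
  also have "\<dots> \<le> L * (\<integral>x. (norm (?E cos x))\<^sup>2 \<partial>lborel) + L * (\<integral>x. (norm (?E sin x))\<^sup>2 \<partial>lborel)"
    by (intro add_mono B sq)
  also have "\<dots> \<le> L * measure lborel \<Omega>"
    unfolding distrib_left[symmetric] using L cos_sin_cutoff_le[OF \<Omega>, of "sgn \<xi>" \<xi>]
    by (intro mult_left_mono) (auto simp: norm_sgn)
  finally show ?thesis .
qed

text \<open>On the Fourier side the left-hand side has the density (z - |\<xi>|^2) times the sum
  bounded in \<open>sum_fourier_power_le\<close>; that pointwise bound leaves only the explicit
  integral of the positive part.\<close>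

lemma sum_riesz_le:
  fixes f :: "'j \<Rightarrow> real^'n::finite \<Rightarrow> real"
  assumes \<Omega>: "\<Omega> \<in> sets borel" "emeasure lborel \<Omega> < \<infinity>" and z: "z \<ge> 0"
    and J: "finite J" "\<And>j. j \<in> J \<Longrightarrow> f j \<in> Cc_inf \<Omega>" and L: "L > 0"
    and gram: "\<And>a. (\<Sum>j\<in>J. \<Sum>k\<in>J. a j * a k * (\<integral>x. grad (f j) x \<bullet> grad (f k) x \<partial>lborel)) \<le> L * (\<Sum>j\<in>J. (a j)\<^sup>2)"
  shows "(2 * pi) ^ CARD('n) * (\<Sum>j\<in>J. z * (\<integral>x. (norm (grad (f j) x))\<^sup>2 \<partial>lborel) - (\<integral>x. (laplacian (f j) x)\<^sup>2 \<partial>lborel))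
    \<le> L * measure lborel \<Omega> * (2 / (real CARD('n) + 2) * unit_ball_vol CARD('n) * z powr (1 + real CARD('n) / 2))"
proof -
  let ?F = "\<lambda>\<xi>. \<Sum>j\<in>J. z * ((norm \<xi>)\<^sup>2 * fourier_power (f j) \<xi>) - (norm \<xi>) ^ 4 * fourier_power (f j) \<xi>"
  have 1: "has_bochner_integral lborel ?F
     (\<Sum>j\<in>J. z * ((2 * pi) ^ CARD('n) * (\<integral>x. (norm (grad (f j) x))\<^sup>2 \<partial>lborel)) - (2 * pi) ^ CARD('n) * (\<integral>x. (laplacian (f j) x)\<^sup>2 \<partial>lborel))"
    by (intro has_bochner_integral_sum has_bochner_integral_diff has_bochner_integral_mult_right
        grad_plancherel[OF J(2)] laplacian_plancherel[OF J(2)])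
  have 2: "has_bochner_integral lborel (\<lambda>\<xi>::real^'n. L * measure lborel \<Omega> * max (z - (norm \<xi>)\<^sup>2) 0)
    (L * measure lborel \<Omega> * (2 / (real CARD('n) + 2) * unit_ball_vol CARD('n) * z powr (1 + real CARD('n) / 2)))"
    using integral_max_diff_norm_power2[OF z, where 'a="real^'n"]
    by (intro has_bochner_integral_mult_right) simp
  have le: "?F \<xi> \<le> L * measure lborel \<Omega> * max (z - (norm \<xi>)\<^sup>2) 0" for \<xi>
  proof -
    have "?F \<xi> = (z - (norm \<xi>)\<^sup>2) * (\<Sum>j\<in>J. (norm \<xi>)\<^sup>2 * fourier_power (f j) \<xi>)"
      unfolding sum_distrib_left by (intro sum.cong refl) (simp add: algebra_simps power2_eq_square power4_eq_xxxx)
    \<comment> \<open>The sum has only an upper bound, so the possibly negative factor must be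
      replaced by its positive part before that bound is applied.\<close>
    also have "\<dots> \<le> max (z - (norm \<xi>)\<^sup>2) 0 * (\<Sum>j\<in>J. (norm \<xi>)\<^sup>2 * fourier_power (f j) \<xi>)"
      by (intro mult_right_mono sum_nonneg mult_nonneg_nonneg fourier_power_nonneg) auto
    also have "\<dots> \<le> max (z - (norm \<xi>)\<^sup>2) 0 * (L * measure lborel \<Omega>)"
      by (intro mult_left_mono sum_fourier_power_le[OF \<Omega> J L gram]) auto
    finally show ?thesis by (simp add: mult.commute)
  qed
  from has_bochner_integral_mono[OF 1 2 le] show ?thesis
    by (simp add: sum_distrib_left right_diff_distrib mult_ac)
qed

section \<open>A Poincare inequality on sets of finite measure\<close>

lemma fourier_power_le:
  fixes f :: "real^'n::finite \<Rightarrow> real"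
  assumes \<Omega>: "\<Omega> \<in> sets borel" "emeasure lborel \<Omega> < \<infinity>" and f: "f \<in> Cc_inf \<Omega>"
  shows "fourier_power f \<xi> \<le> (\<integral>x. (f x)\<^sup>2 \<partial>lborel) * measure lborel \<Omega>"
proof (cases "(\<integral>x. (f x)\<^sup>2 \<partial>lborel) = 0")
  case True
  then have "AE x in lborel. f x = 0"
    using integral_nonneg_eq_0_iff_AE[OF Cc_inf_power2_integrable[OF f]] by simp
  then have "cos_transform f \<xi> = 0" "sin_transform f \<xi> = 0"
    unfolding cos_transform_def sin_transform_def by (auto intro!: integral_eq_zero_AE)
  then show ?thesis using True by (simp add: fourier_power_def)
next
  case False
  then have L: "(\<integral>x. (f x)\<^sup>2 \<partial>lborel) > 0" by (simp add: less_le)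
  let ?E = "\<lambda>h x. (indicator \<Omega> x * h (\<xi> \<bullet> x)) *\<^sub>R (1::real)"
  have sq: "square_integrable lborel (?E cos)" "square_integrable lborel (?E sin)"
    by (rule square_integrable_cutoff[OF \<Omega>]; simp)+
  \<comment> \<open>Cauchy-Schwarz, as the approximate Bessel inequality for the single function f
    with L = ||f||^2. This L has to be positive, which is why the case of norm zero was split
    off.\<close>
  have B: "(\<integral>x. f x \<bullet> E x \<partial>lborel)\<^sup>2 \<le> (\<integral>x. (f x)\<^sup>2 \<partial>lborel) * (\<integral>x. (norm (E x))\<^sup>2 \<partial>lborel)"
    if "square_integrable lborel E" for E
    using approximate_bessel[of "{()}" lborel "\<lambda>_. f" E, OF _ Cc_inf_square_integrable[OF f] that L]
    by (simp add: power2_eq_square mult_ac)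
  have c: "(\<integral>x. f x \<bullet> ?E cos x \<partial>lborel) = cos_transform f \<xi>" "(\<integral>x. f x \<bullet> ?E sin x \<partial>lborel) = sin_transform f \<xi>"
    unfolding cos_transform_def sin_transform_def
    by (auto intro!: Bochner_Integration.integral_cong simp: indicator_def Cc_inf_zero[OF f])
  have "fourier_power f \<xi> \<le> (\<integral>x. (f x)\<^sup>2 \<partial>lborel) * (\<integral>x. (norm (?E cos x))\<^sup>2 \<partial>lborel) + (\<integral>x. (f x)\<^sup>2 \<partial>lborel) * (\<integral>x. (norm (?E sin x))\<^sup>2 \<partial>lborel)"
    unfolding fourier_power_def c[symmetric] by (intro add_mono B sq)
  also have "\<dots> \<le> (\<integral>x. (f x)\<^sup>2 \<partial>lborel) * measure lborel \<Omega>"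
    unfolding distrib_left[symmetric] using L cos_sin_cutoff_le[OF \<Omega>, of "1::real" \<xi>]
    by (intro mult_left_mono) auto
  finally show ?thesis .
qed

text \<open>Low frequencies are absorbed because the transform is bounded by the L2 norm on a set of finite
  measure; for high frequencies the gradient dominates.\<close>

lemma poincare_inequality:
  fixes \<Omega> :: "(real^'n::finite) set"
  assumes \<Omega>: "\<Omega> \<in> sets borel" "emeasure lborel \<Omega> < \<infinity>"
  obtains C where "\<And>f. f \<in> Cc_inf \<Omega> \<Longrightarrow> (\<integral>x. (f x)\<^sup>2 \<partial>lborel) \<le> C * (\<integral>x. (norm (grad f x))\<^sup>2 \<partial>lborel)"
proof -
  define V where "V = unit_ball_vol (real CARD('n)) * measure lborel \<Omega>"
  \<comment> \<open>\<open>r\<close> is the frequency threshold. \<open>V * r ^ CARD('n)\<close> is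
    |\<Omega>| times the volume of the ball of radius r; since r \<le> 1 it is at most V / (1 + 2 V)
    \<le> 1/2. As (2 pi)^d \<ge> 1, the low frequencies then make up at most half of the left-hand
    side and can be absorbed there.\<close>
  define r where "r = 1 / (1 + 2 * V)"
  have V: "V \<ge> 0" by (simp add: V_def)
  have r: "0 < r" "r \<le> 1" using V by (auto simp: r_def)
  have "V * r ^ CARD('n) \<le> V * r ^ 1" using r V by (intro mult_left_mono power_decreasing) auto
  also have "\<dots> \<le> 1 / 2" using V by (simp add: r_def field_simps)
  finally have Vr: "V * r ^ CARD('n) \<le> 1 / 2" .
  have pi1: "(2 * pi) ^ CARD('n) \<ge> 1" using pi_gt3 by (intro one_le_power) auto
  have "(\<integral>x. (f x)\<^sup>2 \<partial>lborel) \<le> 2 / r\<^sup>2 * (\<integral>x. (norm (grad f x))\<^sup>2 \<partial>lborel)" if f: "f \<in> Cc_inf \<Omega>" for f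
  proof -
    let ?n = "\<integral>x. (f x)\<^sup>2 \<partial>lborel" and ?g = "\<integral>x. (norm (grad f x))\<^sup>2 \<partial>lborel" and ?p = "(2 * pi) ^ CARD('n)"
    have 1: "has_bochner_integral lborel (\<lambda>\<xi>. ?n * measure lborel \<Omega> * indicator (ball (0::real^'n) r) \<xi> + 1 / r\<^sup>2 * ((norm \<xi>)\<^sup>2 * fourier_power f \<xi>))
       (?n * measure lborel \<Omega> * measure lborel (ball (0::real^'n) r) + 1 / r\<^sup>2 * (?p * ?g))"
      using emeasure_bounded_finite[OF bounded_ball, of "0::real^'n" r]
      by (intro has_bochner_integral_add has_bochner_integral_mult_right grad_plancherel[OF f] has_bochner_integral_real_indicator) auto
    have le: "fourier_power f \<xi> \<le> ?n * measure lborel \<Omega> * indicator (ball (0::real^'n) r) \<xi> + 1 / r\<^sup>2 * ((norm \<xi>)\<^sup>2 * fourier_power f \<xi>)" for \<xi>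
    proof (cases "norm \<xi> < r")
      case True
      then show ?thesis
        using fourier_power_le[OF \<Omega> f, of \<xi>] fourier_power_nonneg[of f \<xi>] by (simp add: add_increasing2)
    next
      case False
      then have "r\<^sup>2 \<le> (norm \<xi>)\<^sup>2" using r by (intro power_mono) auto
      then have "r\<^sup>2 * fourier_power f \<xi> \<le> (norm \<xi>)\<^sup>2 * fourier_power f \<xi>" by (intro mult_right_mono fourier_power_nonneg)
      then show ?thesis using False r by (simp add: field_simps)
    qed
    have "?p * ?n \<le> ?n * measure lborel \<Omega> * measure lborel (ball (0::real^'n) r) + 1 / r\<^sup>2 * (?p * ?g)"
      by (rule has_bochner_integral_mono[OF Cc_inf_plancherel[OF f] 1 le])
    also have "?n * measure lborel \<Omega> * measure lborel (ball (0::real^'n) r) = ?n * (V * r ^ CARD('n))"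
      using content_ball[of r "0::real^'n"] r by (simp add: V_def mult_ac)
    also have "\<dots> \<le> ?n * (?p / 2)" using Vr pi1 by (intro mult_left_mono) auto
    finally have "?p * ?n \<le> ?n * (?p / 2) + 1 / r\<^sup>2 * (?p * ?g)" by simp
    moreover have "1 / r\<^sup>2 * (?p * ?g) = ?p * (1 / r\<^sup>2 * ?g)" by (rule mult.left_commute)
    moreover have "?p * (?n / 2) = ?p * ?n - ?n * (?p / 2)" by simp
    ultimately have "?p * (?n / 2) \<le> ?p * (1 / r\<^sup>2 * ?g)" by linarith
    then have "?n / 2 \<le> 1 / r\<^sup>2 * ?g" using pi1 by (subst (asm) mult_le_cancel_left_pos) auto
    then show ?thesis by (simp add: field_simps)
  qed
  then show thesis by (rule that)
qed

subsection \<open>Limits and orthonormalisation\<close>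

lemma integral_Cauchy_Schwarz:
  assumes u: "square_integrable M u" and v: "square_integrable M v"
  shows "\<bar>\<integral>x. u x \<bullet> v x \<partial>M\<bar> \<le> sqrt (\<integral>x. (norm (u x))\<^sup>2 \<partial>M) * sqrt (\<integral>x. (norm (v x))\<^sup>2 \<partial>M)"
proof (cases "(\<integral>x. (norm (u x))\<^sup>2 \<partial>M) = 0")
  case True
  then have "AE x in M. u x = 0"
    using integral_nonneg_eq_0_iff_AE[of M "\<lambda>x. (norm (u x))\<^sup>2"] u by (simp add: square_integrable_def)
  then have "AE x in M. u x \<bullet> v x = 0" by eventually_elim simp
  then have "(\<integral>x. u x \<bullet> v x \<partial>M) = 0" by (rule integral_eq_zero_AE)
  then show ?thesis by simp
next
  case False
  then have "(\<integral>x. (norm (u x))\<^sup>2 \<partial>M) > 0" by (simp add: less_le)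
  then have "(\<integral>x. u x \<bullet> v x \<partial>M)\<^sup>2 \<le> (\<integral>x. (norm (u x))\<^sup>2 \<partial>M) * (\<integral>x. (norm (v x))\<^sup>2 \<partial>M)"
    using approximate_bessel[of "{()}" M "\<lambda>_. u" v, OF _ u v]
    by (simp add: power2_eq_square mult_ac power2_norm_eq_inner[unfolded power2_eq_square])
  then have "sqrt ((\<integral>x. u x \<bullet> v x \<partial>M)\<^sup>2) \<le> sqrt ((\<integral>x. (norm (u x))\<^sup>2 \<partial>M) * (\<integral>x. (norm (v x))\<^sup>2 \<partial>M))"
    by (rule real_sqrt_le_mono)
  then show ?thesis by (simp add: real_sqrt_mult)
qed

lemma integral_inner_tendsto:
  assumes u: "\<And>k. square_integrable M (u k)" "square_integrable M u'"
    and v: "\<And>k. square_integrable M (v k)" "square_integrable M v'"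
    and ul: "(\<lambda>k. \<integral>x. (norm (u k x - u' x))\<^sup>2 \<partial>M) \<longlonglongrightarrow> 0"
    and vl: "(\<lambda>k. \<integral>x. (norm (v k x - v' x))\<^sup>2 \<partial>M) \<longlonglongrightarrow> 0"
  shows "(\<lambda>k. \<integral>x. u k x \<bullet> v k x \<partial>M) \<longlonglongrightarrow> (\<integral>x. u' x \<bullet> v' x \<partial>M)"
proof -
  let ?n = "\<lambda>f. sqrt (\<integral>x. (norm (f x))\<^sup>2 \<partial>M)"
  have du: "square_integrable M (\<lambda>x. u k x - u' x)" and dv: "square_integrable M (\<lambda>x. v k x - v' x)" for k
    using u v by (auto intro: square_integrable_diff)
  have lim: "(\<lambda>k. ?n (\<lambda>x. u k x - u' x) * ?n (\<lambda>x. v k x - v' x) + ?n (\<lambda>x. u k x - u' x) * ?n v' + ?n u' * ?n (\<lambda>x. v k x - v' x))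
    \<longlonglongrightarrow> sqrt 0 * sqrt 0 + sqrt 0 * ?n v' + ?n u' * sqrt 0"
    by (intro tendsto_intros ul vl)
  have "(\<lambda>k. (\<integral>x. u k x \<bullet> v k x \<partial>M) - (\<integral>x. u' x \<bullet> v' x \<partial>M)) \<longlonglongrightarrow> 0"
  proof (rule Lim_null_comparison[OF always_eventually])
    show "\<forall>k. norm ((\<integral>x. u k x \<bullet> v k x \<partial>M) - (\<integral>x. u' x \<bullet> v' x \<partial>M))
      \<le> ?n (\<lambda>x. u k x - u' x) * ?n (\<lambda>x. v k x - v' x) + ?n (\<lambda>x. u k x - u' x) * ?n v' + ?n u' * ?n (\<lambda>x. v k x - v' x)"
    proof
      fix k
      let ?a = "\<lambda>x. u k x - u' x" and ?b = "\<lambda>x. v k x - v' x"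
      have "(\<integral>x. u k x \<bullet> v k x \<partial>M) - (\<integral>x. u' x \<bullet> v' x \<partial>M) = (\<integral>x. u k x \<bullet> v k x - u' x \<bullet> v' x \<partial>M)"
        using u v by (simp add: square_integrable_inner)
      also have "\<dots> = (\<integral>x. ?a x \<bullet> ?b x + ?a x \<bullet> v' x + u' x \<bullet> ?b x \<partial>M)"
        by (intro Bochner_Integration.integral_cong) (auto simp: algebra_simps)
      also have "\<dots> = (\<integral>x. ?a x \<bullet> ?b x \<partial>M) + (\<integral>x. ?a x \<bullet> v' x \<partial>M) + (\<integral>x. u' x \<bullet> ?b x \<partial>M)"
        using square_integrable_inner[OF du dv] square_integrable_inner[OF du v(2)] square_integrable_inner[OF u(2) dv] by simp
      finally show "norm ((\<integral>x. u k x \<bullet> v k x \<partial>M) - (\<integral>x. u' x \<bullet> v' x \<partial>M))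
        \<le> ?n ?a * ?n ?b + ?n ?a * ?n v' + ?n u' * ?n ?b"
        using integral_Cauchy_Schwarz[OF du[of k] dv[of k]] integral_Cauchy_Schwarz[OF du[of k] v(2)] integral_Cauchy_Schwarz[OF u(2) dv[of k]]
        unfolding real_norm_def by linarith
    qed
  qed (use lim in simp)
  then show ?thesis by (simp add: LIM_zero_iff)
qed

text \<open>Bridge between the two measures in use: the function spaces are defined over
  \<open>lebesgue_on \<Omega>\<close>, the Fourier analysis takes place on the whole space under
  \<open>lborel\<close>. Test functions are Borel and vanish outside \<Omega>, so both give the same
  integrals.\<close>

lemma integral_lebesgue_on_eq_lborel:
  fixes f :: "'a::euclidean_space \<Rightarrow> real"
  assumes "\<Omega> \<in> sets borel" "f \<in> borel_measurable borel" "\<And>x. x \<notin> \<Omega> \<Longrightarrow> f x = 0"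
  shows "integral\<^sup>L (lebesgue_on \<Omega>) f = integral\<^sup>L lborel f"
proof -
  have "integral\<^sup>L (lebesgue_on \<Omega>) f = integral\<^sup>L lebesgue (\<lambda>x. indicator \<Omega> x *\<^sub>R f x)"
    using assms(1) by (intro integral_restrict_space) auto
  also have "(\<lambda>x. indicator \<Omega> x *\<^sub>R f x) = f" using assms(3) by (auto simp: indicator_def fun_eq_iff)
  finally show ?thesis using assms(2) by (simp add: integral_completion)
qed

lemma square_integrable_lebesgue_on:
  fixes u :: "'a::euclidean_space \<Rightarrow> 'b::euclidean_space"
  assumes "\<Omega> \<in> sets borel" "square_integrable lborel u"
  shows "square_integrable (lebesgue_on \<Omega>) u"
proof -
  have u: "u \<in> borel_measurable borel" "integrable lborel (\<lambda>x. (norm (u x))\<^sup>2)"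
    using assms(2) by (auto simp: square_integrable_def)
  have "integrable lborel (\<lambda>x. indicator \<Omega> x *\<^sub>R (norm (u x))\<^sup>2)"
    using assms(1) by (intro integrable_mult_indicator u) auto
  then have "integrable lebesgue (\<lambda>x. indicator \<Omega> x *\<^sub>R (norm (u x))\<^sup>2)"
    by (subst integrable_completion) auto
  then have "integrable (lebesgue_on \<Omega>) (\<lambda>x. (norm (u x))\<^sup>2)"
    using assms(1) by (subst integrable_restrict_space) auto
  moreover have "u \<in> borel_measurable (lebesgue_on \<Omega>)"
    using u(1) by (intro measurable_restrict_space1 measurable_completion) simp
  ultimately show ?thesis by (simp add: square_integrable_def)
qed

text \<open>Continuity of the inner product combined with the change of measure: the approximants
  live on the whole space, the limits only on \<Omega>. The product vanishes outside \<Omega> as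
  soon as u does.\<close>

lemma L2_conv_inner_tendsto:
  fixes u v :: "nat \<Rightarrow> real^'n::finite \<Rightarrow> 'b::euclidean_space"
  assumes \<Omega>: "\<Omega> \<in> sets borel"
    and u: "L2_conv \<Omega> u u'" "\<And>k. square_integrable lborel (u k)" "\<And>k x. x \<notin> \<Omega> \<Longrightarrow> u k x = 0"
    and v: "L2_conv \<Omega> v v'" "\<And>k. square_integrable lborel (v k)"
  shows "(\<lambda>k. \<integral>x. u k x \<bullet> v k x \<partial>lborel) \<longlonglongrightarrow> (\<integral>x. u' x \<bullet> v' x \<partial>lebesgue_on \<Omega>)"
proof -
  have [measurable]: "u k \<in> borel_measurable borel" "v k \<in> borel_measurable borel" for k
    using u(2)[of k] v(2)[of k] by (auto simp: square_integrable_def)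
  have "(\<lambda>k. \<integral>x. u k x \<bullet> v k x \<partial>lebesgue_on \<Omega>) \<longlonglongrightarrow> (\<integral>x. u' x \<bullet> v' x \<partial>lebesgue_on \<Omega>)"
    by (rule integral_inner_tendsto)
      (use u(1) v(1) in \<open>auto intro!: square_integrable_lebesgue_on[OF \<Omega>] u(2) v(2) simp: L2_conv_def square_integrable_def[of _ u'] square_integrable_def[of _ v']\<close>)
  also have "(\<lambda>k. \<integral>x. u k x \<bullet> v k x \<partial>lebesgue_on \<Omega>) = (\<lambda>k. \<integral>x. u k x \<bullet> v k x \<partial>lborel)"
    by (intro ext integral_lebesgue_on_eq_lborel \<Omega>) (auto simp: u(3))
  finally show ?thesis .
qed

text \<open>Serves the functions, their gradients and their Laplacians alike; the coefficients stay
  fixed while the approximation is refined.\<close>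

lemma L2_conv_inner_sums_tendsto:
  fixes u :: "'j \<Rightarrow> nat \<Rightarrow> real^'n::finite \<Rightarrow> 'b::euclidean_space"
  assumes \<Omega>: "\<Omega> \<in> sets borel" and J: "finite J"
    and u: "\<And>j. j \<in> J \<Longrightarrow> L2_conv \<Omega> (u j) (u' j)" "\<And>j k. j \<in> J \<Longrightarrow> square_integrable lborel (u j k)"
      "\<And>j k x. j \<in> J \<Longrightarrow> x \<notin> \<Omega> \<Longrightarrow> u j k x = 0"
  shows "(\<lambda>k. \<integral>x. (\<Sum>i\<in>J. c i *\<^sub>R u i k x) \<bullet> (\<Sum>j\<in>J. d j *\<^sub>R u j k x) \<partial>lborel)
    \<longlonglongrightarrow> (\<Sum>i\<in>J. \<Sum>j\<in>J. c i * d j * (\<integral>x. u' i x \<bullet> u' j x \<partial>lebesgue_on \<Omega>))"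
proof -
  have "(\<lambda>k. \<Sum>i\<in>J. \<Sum>j\<in>J. c i * d j * (\<integral>x. u i k x \<bullet> u j k x \<partial>lborel))
    \<longlonglongrightarrow> (\<Sum>i\<in>J. \<Sum>j\<in>J. c i * d j * (\<integral>x. u' i x \<bullet> u' j x \<partial>lebesgue_on \<Omega>))"
    by (intro tendsto_intros L2_conv_inner_tendsto[OF \<Omega>]) (use u in auto)
  also have "(\<lambda>k. \<Sum>i\<in>J. \<Sum>j\<in>J. c i * d j * (\<integral>x. u i k x \<bullet> u j k x \<partial>lborel))
    = (\<lambda>k. \<integral>x. (\<Sum>i\<in>J. c i *\<^sub>R u i k x) \<bullet> (\<Sum>j\<in>J. d j *\<^sub>R u j k x) \<partial>lborel)"
    by (intro ext integral_inner_sums[symmetric] J u)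
  finally show ?thesis .
qed

text \<open>Gram-Schmidt for the bilinear form G on coefficient vectors. Because G vanishes between
  different values of \<sigma>, each projection subtracts only vectors with the same \<sigma>. The
  i-th result starts from the i-th unit vector, so it belongs to the value \<open>\<sigma> i\<close>
  and multiplicities are preserved. In the induction the supports stay inside the elements already
  treated.\<close>

lemma gram_schmidt_coefficients:
  fixes G :: "'v \<Rightarrow> 'v \<Rightarrow> real" and \<sigma> :: "'v \<Rightarrow> 'c"
  assumes U: "finite U"
    and sym: "\<And>u v. u \<in> U \<Longrightarrow> v \<in> U \<Longrightarrow> G u v = G v u"
    and pos: "\<And>c. \<exists>u\<in>U. c u \<noteq> 0 \<Longrightarrow> (\<Sum>u\<in>U. \<Sum>v\<in>U. c u * c v * G u v) > 0"
    and block: "\<And>u v. u \<in> U \<Longrightarrow> v \<in> U \<Longrightarrow> \<sigma> u \<noteq> \<sigma> v \<Longrightarrow> G u v = 0"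
  obtains C where
    "\<And>i j. i \<in> U \<Longrightarrow> j \<in> U \<Longrightarrow> (\<Sum>u\<in>U. \<Sum>v\<in>U. C i u * C j v * G u v) = (if i = j then 1 else 0)"
    "\<And>i u. i \<in> U \<Longrightarrow> u \<in> U \<Longrightarrow> C i u \<noteq> 0 \<Longrightarrow> \<sigma> u = \<sigma> i"
proof -
  define B where "B c d = (\<Sum>u\<in>U. \<Sum>v\<in>U. c u * d v * G u v)" for c d
  have Bsym: "B c d = B d c" for c d
    unfolding B_def by (subst sum.swap) (auto intro!: sum.cong simp: sym)
  have Bdiff: "B (\<lambda>u. a u - b u) d = B a d - B b d" for a b d
    by (simp add: B_def left_diff_distrib sum_subtractf)
  have Bscale: "B (\<lambda>u. s * a u) d = s * B a d" for s a d
    by (simp add: B_def sum_distrib_left mult.assoc)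
  have Bsum: "B (\<lambda>u. \<Sum>i\<in>I. b i * c i u) d = (\<Sum>i\<in>I. b i * B (c i) d)" for I b c d
  proof -
    have "B (\<lambda>u. \<Sum>i\<in>I. b i * c i u) d = (\<Sum>u\<in>U. \<Sum>i\<in>I. \<Sum>v\<in>U. b i * (c i u * d v * G u v))"
      unfolding B_def by (intro sum.cong refl, subst sum.swap) (simp add: sum_distrib_left sum_distrib_right mult_ac)
    also have "\<dots> = (\<Sum>i\<in>I. b i * B (c i) d)"
      unfolding B_def by (subst sum.swap) (simp add: sum_distrib_left)
    finally show ?thesis .
  qed
  have "\<exists>C. (\<forall>i\<in>V. \<forall>j\<in>V. B (C i) (C j) = (if i = j then 1 else 0)) \<and>
     (\<forall>i\<in>V. \<forall>u\<in>U. C i u \<noteq> 0 \<longrightarrow> u \<in> V \<and> \<sigma> u = \<sigma> i)" if "V \<subseteq> U" for V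
    using finite_subset[OF that U] that
  proof (induction V rule: finite_induct)
    case (insert w V)
    then have "\<exists>C. (\<forall>i\<in>V. \<forall>j\<in>V. B (C i) (C j) = (if i = j then 1 else 0)) \<and>
     (\<forall>i\<in>V. \<forall>u\<in>U. C i u \<noteq> 0 \<longrightarrow> u \<in> V \<and> \<sigma> u = \<sigma> i)" by blast
    then obtain C where C': "\<forall>i\<in>V. \<forall>j\<in>V. B (C i) (C j) = (if i = j then 1 else 0)"
      and supp': "\<forall>i\<in>V. \<forall>u\<in>U. C i u \<noteq> 0 \<longrightarrow> u \<in> V \<and> \<sigma> u = \<sigma> i" by blast
    have C: "B (C i) (C j) = (if i = j then 1 else 0)" if "i \<in> V" "j \<in> V" for i j
      using C' that by blast
    have supp: "u \<in> V \<and> \<sigma> u = \<sigma> i" if "i \<in> V" "u \<in> U" "C i u \<noteq> 0" for i u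
      using supp' that by blast
    have w: "w \<in> U" "w \<notin> V" using insert by auto
    define e where "e u = (if u = w then 1 else 0 :: real)" for u
    define b where "b i = B e (C i)" for i
    define d where "d u = e u - (\<Sum>i\<in>V. b i * C i u)" for u
    have dC: "B d (C j) = 0" if "j \<in> V" for j
    proof -
      have "(\<Sum>i\<in>V. b i * B (C i) (C j)) = (\<Sum>i\<in>V. if i = j then b j else 0)"
        using that by (intro sum.cong refl) (simp add: C)
      also have "\<dots> = b j" using that insert(1) by simp
      finally show ?thesis unfolding d_def Bdiff Bsum by (simp add: b_def)
    qed
    \<comment> \<open>The earlier vectors are supported in V, which does not contain w. Hence
      \<open>d w = 1\<close>, so \<open>d\<close> is nonzero and definiteness of G allows it to be
      normalised.\<close>
    have "(\<Sum>i\<in>V. b i * C i w) = 0"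
    proof (rule sum.neutral, rule ballI)
      fix i assume "i \<in> V"
      then show "b i * C i w = 0" using supp[of i w] w by auto
    qed
    then have "d w = 1" unfolding d_def by (simp add: e_def)
    then have N: "B d d > 0" unfolding B_def using w by (intro pos) (auto intro!: bexI[of _ w])
    \<comment> \<open>If \<open>C i\<close> contributes to \<open>d\<close> at u, then
      \<open>b i\<close> is nonzero, so some v in the support of \<open>C i\<close> has
      \<open>G w v\<close> nonzero. Then \<sigma> agrees at w and v by \<open>block\<close>, and at
      v, i and u by the support property.\<close>
    have dsupp: "u \<in> insert w V \<and> \<sigma> u = \<sigma> w" if u: "u \<in> U" "d u \<noteq> 0" for u
    proof (cases "u = w")
      case False
      then have "(\<Sum>i\<in>V. b i * C i u) \<noteq> 0" using u by (simp add: d_def e_def)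
      then obtain i where i: "i \<in> V" "b i * C i u \<noteq> 0" by (rule sum.not_neutral_contains_not_neutral)
      have "b i = (\<Sum>v\<in>U. C i v * G w v)"
        unfolding b_def B_def e_def using U w by (simp add: if_distribR if_distrib sum.If_cases Int_absorb1 cong: if_cong)
      then have "(\<Sum>v\<in>U. C i v * G w v) \<noteq> 0" using i(2) by auto
      then obtain v where v: "v \<in> U" "C i v * G w v \<noteq> 0" by (rule sum.not_neutral_contains_not_neutral)
      then have "\<sigma> w = \<sigma> v" using block w by auto
      then show ?thesis using supp[OF i(1) v(1)] supp[OF i(1) u(1)] i v by auto
    qed simp
    let ?C = "\<lambda>i. if i = w then (\<lambda>u. 1 / sqrt (B d d) * d u) else C i"
    have ww: "B (\<lambda>u. 1 / sqrt (B d d) * d u) (\<lambda>u. 1 / sqrt (B d d) * d u) = 1"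
      unfolding Bscale Bsym[of d "\<lambda>u. 1 / sqrt (B d d) * d u"] using N by (simp add: field_simps)
    have wC: "B (\<lambda>u. 1 / sqrt (B d d) * d u) (C j) = 0" "B (C j) (\<lambda>u. 1 / sqrt (B d d) * d u) = 0" if "j \<in> V" for j
      unfolding Bsym[of "C j"] Bscale dC[OF that] by (rule mult_zero_right)+
    show ?case
    proof (intro exI[of _ ?C] conjI ballI impI)
      fix i j assume "i \<in> insert w V" "j \<in> insert w V"
      then show "B (?C i) (?C j) = (if i = j then 1 else 0)"
        using ww wC C w(2) by (cases "i = w"; cases "j = w") auto
    next
      fix i u assume iu: "i \<in> insert w V" "u \<in> U" "?C i u \<noteq> 0"
      then have "u \<in> insert w V \<and> \<sigma> u = \<sigma> i"
        using dsupp[of u] supp[of i u] by (cases "i = w") auto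
      then show "u \<in> insert w V" "\<sigma> u = \<sigma> i" by simp_all
    qed
  qed simp
  from this[OF order_refl] obtain C where
    "\<forall>i\<in>U. \<forall>j\<in>U. B (C i) (C j) = (if i = j then 1 else 0)"
    "\<forall>i\<in>U. \<forall>u\<in>U. C i u \<noteq> 0 \<longrightarrow> u \<in> U \<and> \<sigma> u = \<sigma> i" by blast
  then show thesis
    by (intro that[of C]) (simp_all add: B_def)
qed

text \<open>The identity part of M contributes the sum of squares, and every product
  \<open>a i * a j\<close> is bounded by that same sum, so the entrywise distance to the identity
  controls the error. This is cruder than the operator norm, but it tends to 0 when the entries
  converge.\<close>

lemma gram_perturbation:
  fixes M :: "'i \<Rightarrow> 'i \<Rightarrow> real"
  assumes "finite W"
  shows "(\<Sum>i\<in>W. \<Sum>j\<in>W. a i * a j * M i j)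
    \<le> (1 + (\<Sum>i\<in>W. \<Sum>j\<in>W. \<bar>M i j - (if i = j then 1 else 0)\<bar>)) * (\<Sum>i\<in>W. (a i)\<^sup>2)"
proof -
  let ?S = "\<Sum>i\<in>W. (a i)\<^sup>2" and ?D = "\<lambda>i j. if i = j then 1 else 0 :: real"
  have le: "a i * a j * M i j \<le> a i * a j * ?D i j + \<bar>M i j - ?D i j\<bar> * ?S" if "i \<in> W" "j \<in> W" for i j
  proof -
    have sq: "(a i)\<^sup>2 \<le> ?S" "(a j)\<^sup>2 \<le> ?S" using assms that by (auto intro!: member_le_sum)
    have "2 * \<bar>a i\<bar> * \<bar>a j\<bar> \<le> (a i)\<^sup>2 + (a j)\<^sup>2" using sum_squares_bound[of "\<bar>a i\<bar>" "\<bar>a j\<bar>"] by simp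
    then have S: "\<bar>a i * a j\<bar> \<le> ?S" using sq unfolding abs_mult by linarith
    have "a i * a j * (M i j - ?D i j) \<le> \<bar>a i * a j\<bar> * \<bar>M i j - ?D i j\<bar>"
      unfolding abs_mult[symmetric] by (rule abs_ge_self)
    also have "\<dots> \<le> ?S * \<bar>M i j - ?D i j\<bar>" by (rule mult_right_mono[OF S abs_ge_zero])
    finally show ?thesis by (simp add: right_diff_distrib mult.commute[of ?S])
  qed
  have "(\<Sum>i\<in>W. \<Sum>j\<in>W. a i * a j * M i j) \<le> (\<Sum>i\<in>W. \<Sum>j\<in>W. a i * a j * ?D i j + \<bar>M i j - ?D i j\<bar> * ?S)"
    by (intro sum_mono le)
  also have "\<dots> = (\<Sum>i\<in>W. \<Sum>j\<in>W. a i * a j * ?D i j) + (\<Sum>i\<in>W. \<Sum>j\<in>W. \<bar>M i j - ?D i j\<bar>) * ?S"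
    by (simp only: sum.distrib sum_distrib_right)
  also have "(\<Sum>i\<in>W. \<Sum>j\<in>W. a i * a j * ?D i j) = ?S"
    using assms by (simp add: if_distrib power2_eq_square cong: if_cong)
  finally show ?thesis by (simp add: algebra_simps)
qed

subsection \<open>The Riesz mean of the buckling eigenvalues\<close>

text \<open>A finite family of eigenfunctions that is linearly independent almost everywhere encodes
  finitely many eigenvalues repeated according to multiplicity. The sum over all j is the supremum
  of such finite sums, and the bound does not depend on \<open>V\<close>.\<close>

theorem mainTheorem11:
  fixes \<Omega> :: "(real^'n::finite) set"
    and z :: real
    and V :: "(real^'n \<Rightarrow> real) set"
    and \<sigma> :: "(real^'n \<Rightarrow> real) \<Rightarrow> real"
  assumes "open \<Omega>" and "connected \<Omega>"
    and "emeasure lebesgue \<Omega> < \<infinity>"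
    and "z \<ge> 0"
    and "finite V" and "lin_indep_on \<Omega> V"
    and "\<forall>v\<in>V. buckling_eigenfunction \<Omega> (\<sigma> v) v"
  shows "(\<Sum>v\<in>V. max (z - \<sigma> v) 0)
           \<le> 2 / (real CARD('n) + 2) * (2 * pi) powr (- real CARD('n))
              * measure lebesgue (ball (0::real^'n) 1) * measure lebesgue \<Omega>
              * z powr (1 + real CARD('n) / 2)"
proof -
  have \<Omega>: "\<Omega> \<in> sets borel" "emeasure lborel \<Omega> < \<infinity>" using assms(1,3) by auto
  have fin: "finite V" by fact
  have "\<forall>v\<in>V. \<exists>g w. H20_rep \<Omega> v g w"
    using assms(7) by (auto simp: buckling_eigenfunction_def H20_def)
  then obtain g w where rep: "\<And>v. v \<in> V \<Longrightarrow> H20_rep \<Omega> v (g v) (w v)" by metis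
  then have "\<forall>v\<in>V. \<exists>\<phi>. (\<forall>k. \<phi> k \<in> Cc_inf \<Omega>) \<and> L2_conv \<Omega> \<phi> v \<and>
          L2_conv \<Omega> (\<lambda>k. grad (\<phi> k)) (g v) \<and> L2_conv \<Omega> (\<lambda>k. laplacian (\<phi> k)) (w v)"
    by (auto simp: H20_rep_def)
  then obtain \<phi> where \<phi>: "\<And>v k. v \<in> V \<Longrightarrow> \<phi> v k \<in> Cc_inf \<Omega>"
    and conv: "\<And>v. v \<in> V \<Longrightarrow> L2_conv \<Omega> (\<phi> v) v" "\<And>v. v \<in> V \<Longrightarrow> L2_conv \<Omega> (\<lambda>k. grad (\<phi> v k)) (g v)"
      "\<And>v. v \<in> V \<Longrightarrow> L2_conv \<Omega> (\<lambda>k. laplacian (\<phi> v k)) (w v)"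
    by metis
  define G where "G u v = (\<integral>x. g u x \<bullet> g v x \<partial>lebesgue_on \<Omega>)" for u v
  \<comment> \<open>The weak equation of \<open>u\<close> is tested with the eigenfunction
    \<open>v\<close>, itself an element of the closure space. The equation is imposed for all
    representations by limits of gradients and Laplacians, hence for the chosen \<open>g\<close> and
    \<open>w\<close>.\<close>
  have K: "(\<integral>x. w u x * w v x \<partial>lebesgue_on \<Omega>) = \<sigma> u * G u v" if "u \<in> V" "v \<in> V" for u v
    using assms(7) that rep[of u] rep[of v] unfolding buckling_eigenfunction_def G_def by blast
  have sym: "G u v = G v u" for u v by (simp add: G_def inner_commute)
  \<comment> \<open>The integral of \<open>w u * w v\<close> is symmetric in u and v, so
    \<open>K\<close> read both ways gives the same \<open>G u v\<close> with the factors
    \<open>\<sigma> u\<close> and \<open>\<sigma> v\<close>.\<close>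
  have block: "G u v = 0" if "u \<in> V" "v \<in> V" "\<sigma> u \<noteq> \<sigma> v" for u v
  proof -
    have "\<sigma> u * G u v = \<sigma> v * G u v" using K[OF that(1,2)] K[OF that(2,1)] by (simp add: sym[of v u] mult.commute)
    then show ?thesis using that(3) by simp
  qed
  define \<psi> where "\<psi> c k = (\<lambda>x. \<Sum>v\<in>V. c v * \<phi> v k x)" for c k
  have \<psi>: "\<psi> c k \<in> Cc_inf \<Omega>" for c k
    unfolding \<psi>_def using fin \<phi> by (rule Cc_inf_sum)
  have grad\<psi>: "grad (\<psi> c k) = (\<lambda>x. \<Sum>v\<in>V. c v *\<^sub>R grad (\<phi> v k) x)" for c k
    unfolding \<psi>_def using \<phi> by (rule grad_sum)
  have lap\<psi>: "laplacian (\<psi> c k) = (\<lambda>x. \<Sum>v\<in>V. c v * laplacian (\<phi> v k) x)" for c k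
    unfolding \<psi>_def using \<phi> by (rule laplacian_sum)
  have grad_lim: "(\<lambda>k. \<integral>x. grad (\<psi> c k) x \<bullet> grad (\<psi> d k) x \<partial>lborel) \<longlonglongrightarrow> (\<Sum>u\<in>V. \<Sum>v\<in>V. c u * d v * G u v)" for c d
    unfolding grad\<psi> G_def
    by (rule L2_conv_inner_sums_tendsto[OF \<Omega>(1) fin]) (use conv in \<open>auto intro: grad_square_integrable[OF \<phi>] grad_zero[OF \<phi>]\<close>)
  have lap_lim: "(\<lambda>k. \<integral>x. (laplacian (\<psi> c k) x)\<^sup>2 \<partial>lborel) \<longlonglongrightarrow> (\<Sum>u\<in>V. \<Sum>v\<in>V. c u * c v * (\<sigma> u * G u v))" for c
  proof -
    have "(\<lambda>k. \<integral>x. (\<Sum>v\<in>V. c v *\<^sub>R laplacian (\<phi> v k) x) \<bullet> (\<Sum>v\<in>V. c v *\<^sub>R laplacian (\<phi> v k) x) \<partial>lborel)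
       \<longlonglongrightarrow> (\<Sum>u\<in>V. \<Sum>v\<in>V. c u * c v * (\<integral>x. w u x \<bullet> w v x \<partial>lebesgue_on \<Omega>))"
      by (rule L2_conv_inner_sums_tendsto[OF \<Omega>(1) fin])
        (use conv in \<open>auto intro: Cc_inf_square_integrable[OF Cc_inf_laplacian[OF \<phi>]] Cc_inf_zero[OF Cc_inf_laplacian[OF \<phi>]]\<close>)
    then show ?thesis by (simp add: lap\<psi> power2_eq_square K cong: sum.cong)
  qed
  \<comment> \<open>If the form vanished at c, the gradients of the approximants
    \<open>\<psi> c k\<close> would tend to 0. The Poincare inequality, available for test
    functions, then forces the approximants themselves to 0, and their limit, the combination of the
    eigenfunctions, would vanish almost everywhere.\<close>
  have pos: "(\<Sum>u\<in>V. \<Sum>v\<in>V. c u * c v * G u v) > 0" if c: "\<exists>u\<in>V. c u \<noteq> 0" for c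
  proof (rule ccontr)
    let ?q = "\<Sum>u\<in>V. \<Sum>v\<in>V. c u * c v * G u v"
    have lim: "(\<lambda>k. \<integral>x. (norm (grad (\<psi> c k) x))\<^sup>2 \<partial>lborel) \<longlonglongrightarrow> ?q"
      using grad_lim[of c c] by (simp add: power2_norm_eq_inner)
    have "?q \<ge> 0" by (rule LIMSEQ_le_const[OF lim]) (auto intro!: integral_nonneg)
    moreover assume "\<not> ?q > 0"
    ultimately have "?q = 0" by simp
    obtain C where C: "\<And>f. f \<in> Cc_inf \<Omega> \<Longrightarrow> (\<integral>x. (f x)\<^sup>2 \<partial>lborel) \<le> C * (\<integral>x. (norm (grad f x))\<^sup>2 \<partial>lborel)"
      using poincare_inequality[OF \<Omega>] by blast
    have "(\<lambda>k. \<integral>x. (\<psi> c k x)\<^sup>2 \<partial>lborel) \<longlonglongrightarrow> 0"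
    proof (rule tendsto_sandwich[OF _ _ tendsto_const])
      show "(\<lambda>k. C * (\<integral>x. (norm (grad (\<psi> c k) x))\<^sup>2 \<partial>lborel)) \<longlonglongrightarrow> 0"
        using tendsto_mult_left[OF lim, of C] \<open>?q = 0\<close> by simp
    qed (use C[OF \<psi>] in \<open>auto intro!: always_eventually integral_nonneg\<close>)
    moreover have "(\<lambda>k. \<integral>x. (\<Sum>v\<in>V. c v *\<^sub>R \<phi> v k x) \<bullet> (\<Sum>v\<in>V. c v *\<^sub>R \<phi> v k x) \<partial>lborel)
       \<longlonglongrightarrow> (\<Sum>u\<in>V. \<Sum>v\<in>V. c u * c v * (\<integral>x. u x \<bullet> v x \<partial>lebesgue_on \<Omega>))"
      by (rule L2_conv_inner_sums_tendsto[OF \<Omega>(1) fin])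
        (use conv in \<open>auto intro: Cc_inf_square_integrable[OF \<phi>] Cc_inf_zero[OF \<phi>]\<close>)
    ultimately have z: "(\<Sum>u\<in>V. \<Sum>v\<in>V. c u * c v * (\<integral>x. u x \<bullet> v x \<partial>lebesgue_on \<Omega>)) = 0"
      by (intro LIMSEQ_unique) (auto simp: \<psi>_def power2_eq_square)
    have sq: "square_integrable (lebesgue_on \<Omega>) v" if "v \<in> V" for v
      using conv(1)[OF that] by (simp add: L2_conv_def square_integrable_def)
    have "square_integrable (lebesgue_on \<Omega>) (\<lambda>x. \<Sum>v\<in>V. c v *\<^sub>R v x)"
      by (rule square_integrable_sum[OF fin, of "lebesgue_on \<Omega>" "\<lambda>v. v", OF sq])
    moreover have "(\<integral>x. (\<Sum>v\<in>V. c v *\<^sub>R v x) \<bullet> (\<Sum>v\<in>V. c v *\<^sub>R v x) \<partial>lebesgue_on \<Omega>) = 0"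
      using integral_inner_sums[OF fin sq fin sq, of "\<lambda>v. v" "\<lambda>v. v"] z by simp
    ultimately have "AE x in lebesgue_on \<Omega>. (\<Sum>v\<in>V. c v * v x) = 0"
      using integral_nonneg_eq_0_iff_AE[of "lebesgue_on \<Omega>" "\<lambda>x. (\<Sum>v\<in>V. c v * v x)\<^sup>2"]
      by (simp add: square_integrable_def power2_eq_square)
    then show False using assms(6) c by (auto simp: lin_indep_on_def)
  qed
  obtain C where C: "\<And>i j. i \<in> V \<Longrightarrow> j \<in> V \<Longrightarrow> (\<Sum>u\<in>V. \<Sum>v\<in>V. C i u * C j v * G u v) = (if i = j then 1 else 0)"
    and supp: "\<And>i u. i \<in> V \<Longrightarrow> u \<in> V \<Longrightarrow> C i u \<noteq> 0 \<Longrightarrow> \<sigma> u = \<sigma> i"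
    using gram_schmidt_coefficients[of V G \<sigma>, OF fin sym pos block] by blast
  \<comment> \<open>Wherever \<open>C i u\<close> is nonzero, \<open>\<sigma> u\<close> equals
    \<open>\<sigma> i\<close> and can be pulled out of the sum; what remains is the normalisation of
    \<open>C i\<close>.\<close>
  have lapC: "(\<Sum>u\<in>V. \<Sum>v\<in>V. C i u * C i v * (\<sigma> u * G u v)) = \<sigma> i" if "i \<in> V" for i
  proof -
    have "(\<Sum>u\<in>V. \<Sum>v\<in>V. C i u * C i v * (\<sigma> u * G u v)) = (\<Sum>u\<in>V. \<Sum>v\<in>V. \<sigma> i * (C i u * C i v * G u v))"
      using supp[OF that] by (intro sum.cong refl) (metis mult.assoc mult.left_commute mult_zero_left)
    also have "\<dots> = \<sigma> i" using C[OF that that] by (simp flip: sum_distrib_left)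
    finally show ?thesis .
  qed
  \<comment> \<open>The estimate holds for any subset of the orthonormal family. Choosing exactly
    the indices with \<open>z - \<sigma> v\<close> positive turns its left-hand side into the sum of
    positive parts.\<close>
  define W where "W = {v\<in>V. \<sigma> v < z}"
  have W: "finite W" "\<And>v. v \<in> W \<Longrightarrow> v \<in> V" using fin by (auto simp: W_def)
  define M where "M k i j = (\<integral>x. grad (\<psi> (C i) k) x \<bullet> grad (\<psi> (C j) k) x \<partial>lborel)" for k i j
  \<comment> \<open>Distance of the Gram matrix of the k-th approximants from the identity;
    \<open>1 + \<epsilon> k\<close> is the admissible L at stage k and tends to 1.\<close>
  define \<epsilon> where "\<epsilon> k = (\<Sum>i\<in>W. \<Sum>j\<in>W. \<bar>M k i j - (if i = j then 1 else 0)\<bar>)" for k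
  let ?R = "measure lborel \<Omega> * (2 / (real CARD('n) + 2) * unit_ball_vol CARD('n) * z powr (1 + real CARD('n) / 2))"
  have Mlim: "(\<lambda>k. M k i j) \<longlonglongrightarrow> (if i = j then 1 else 0)" if "i \<in> W" "j \<in> W" for i j
    using grad_lim[of "C i" "C j"] C[of i j] W that unfolding M_def by simp
  have "\<epsilon> \<longlonglongrightarrow> (\<Sum>i\<in>W. \<Sum>j\<in>W. \<bar>(if i = j then 1 else 0) - (if i = j then 1 else 0)\<bar>)"
    unfolding \<epsilon>_def[abs_def] by (intro tendsto_intros Mlim)
  then have \<epsilon>: "\<epsilon> \<longlonglongrightarrow> 0" by simp
  have bound: "(2 * pi) ^ CARD('n) * (\<Sum>i\<in>W. z * M k i i - (\<integral>x. (laplacian (\<psi> (C i) k) x)\<^sup>2 \<partial>lborel)) \<le> (1 + \<epsilon> k) * ?R" for k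
  proof -
    have "1 + \<epsilon> k > 0" unfolding \<epsilon>_def by (intro add_pos_nonneg sum_nonneg) auto
    moreover have "(\<Sum>i\<in>W. \<Sum>j\<in>W. a i * a j * (\<integral>x. grad (\<psi> (C i) k) x \<bullet> grad (\<psi> (C j) k) x \<partial>lborel)) \<le> (1 + \<epsilon> k) * (\<Sum>i\<in>W. (a i)\<^sup>2)" for a
      using gram_perturbation[OF W(1), of a "M k"] unfolding \<epsilon>_def by (simp add: M_def)
    ultimately have "(2 * pi) ^ CARD('n) * (\<Sum>i\<in>W. z * (\<integral>x. (norm (grad (\<psi> (C i) k) x))\<^sup>2 \<partial>lborel) - (\<integral>x. (laplacian (\<psi> (C i) k) x)\<^sup>2 \<partial>lborel))
      \<le> (1 + \<epsilon> k) * measure lborel \<Omega> * (2 / (real CARD('n) + 2) * unit_ball_vol CARD('n) * z powr (1 + real CARD('n) / 2))"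
      by (intro sum_riesz_le[OF \<Omega> assms(4) W(1) \<psi>])
    then show ?thesis by (simp only: M_def power2_norm_eq_inner mult.assoc)
  qed
  have lim: "(\<lambda>k. (2 * pi) ^ CARD('n) * (\<Sum>i\<in>W. z * M k i i - (\<integral>x. (laplacian (\<psi> (C i) k) x)\<^sup>2 \<partial>lborel)))
     \<longlonglongrightarrow> (2 * pi) ^ CARD('n) * (\<Sum>i\<in>W. z * 1 - \<sigma> i)"
  proof (intro tendsto_intros)
    fix i assume i: "i \<in> W"
    show "(\<lambda>k. M k i i) \<longlonglongrightarrow> 1" using Mlim[OF i i] by simp
    show "(\<lambda>k. \<integral>x. (laplacian (\<psi> (C i) k) x)\<^sup>2 \<partial>lborel) \<longlonglongrightarrow> \<sigma> i"
      using lap_lim[of "C i"] lapC[OF W(2)[OF i]] by simp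
  qed
  have "(\<lambda>k. (1 + \<epsilon> k) * ?R) \<longlonglongrightarrow> (1 + 0) * ?R" by (intro tendsto_intros \<epsilon>)
  from LIMSEQ_le[OF lim this] bound
  have main: "(2 * pi) ^ CARD('n) * (\<Sum>i\<in>W. z - \<sigma> i) \<le> ?R"
    by (simp only: mult_1_right mult_1_left add_0_right) blast
  have "(\<Sum>v\<in>V. max (z - \<sigma> v) 0) = (\<Sum>v\<in>W. z - \<sigma> v)"
    by (rule sum.mono_neutral_cong_right) (use fin in \<open>auto simp: W_def max_def\<close>)
  also have "\<dots> \<le> ?R / (2 * pi) ^ CARD('n)"
    using main by (subst pos_le_divide_eq) (simp_all only: mult.commute zero_less_power zero_less_mult_iff pi_gt_zero zero_less_numeral simp_thms)
  also have "\<dots> = 2 / (real CARD('n) + 2) * (2 * pi) powr (- real CARD('n))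
              * measure lebesgue (ball (0::real^'n) 1) * measure lebesgue \<Omega>
              * z powr (1 + real CARD('n) / 2)"
  proof -
    have "(2 * pi) powr (- real CARD('n)) = 1 / (2 * pi) ^ CARD('n)"
      by (simp add: powr_minus powr_realpow inverse_eq_divide)
    moreover have "measure lebesgue (ball (0::real^'n) 1) = unit_ball_vol CARD('n)"
      using content_ball[of 1 "0::real^'n"] by simp
    moreover have "measure lebesgue \<Omega> = measure lborel \<Omega>" using \<Omega> by simp
    ultimately show ?thesis by (simp only:) simp
  qed
  finally show ?thesis .
qed

end
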